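(* Let $n\ge 1$, $1\le p<\infty$, and let $K\subset\mathbb R^n$ be an origin-symmetric convex body. There exists a constant $C=C(n)>0$ depending only on $n$ such that for all $f\in C_c^\infty(\mathbb R^n)$, $$\frac{2}{n}\int_{\mathbb R^n}\|\nabla f(x)\|_{Z_p^*K}^p\,dx\;\le\;\left[\frac{f(x)-f(y)}{\|x-y\|_K^{\frac np+1}}\right]^p_{M^p(\mathbb R^n\times\mathbb R^n,\mathcal L^{2n})}\;\le\; C\int_{\mathbb R^n}\|\nabla f(x)\|_{Z_p^*K}^p\,dx .$$ Moreover, setting for $\lambda>0$ $$E_{\lambda,K}=\left\{(x,y)\in\mathbb R^n\times\mathbb R^n:\ x\neq y,\ \frac{|f(x)-f(y)|}{\|x-y\|_K^{\frac{n}{p}+1}}\geq\lambda\right\},$$ one has $$\lim_{\lambda\to\infty}\lambda^p\,\mathcal L^{2n}(E_{\lambda,K})=\frac{2}{n}\int_{\mathbb R^n}\|\nabla f(x)\|_{Z_p^*K}^p\,dx.$$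
   Context: A convex body is a compact convex subset of $\mathbb R^n$ with non-empty interior; origin-symmetric means $K=-K$. The Minkowski functional is $\|x\|_K=\inf\{\lambda\ge 0: x\in\lambda K\}$, a norm on $\mathbb R^n$. The polar $L^p$ moment body $Z_p^*K$ is defined through its norm $\|z\|_{Z_p^*K}^p=\frac{n+p}{2}\int_K|z\cdot y|^p\,dy$ for $z\in\mathbb R^n$. $\mathcal L^{2n}$ is Lebesgue measure on $\mathbb R^n\times\mathbb R^n$. For a measurable function $g$ on $\mathbb R^n\times\mathbb R^n$ (defined a.e., here off the diagonal $x=y$), the weak $L^p$ (Marcinkiewicz) quasinorm is $[g]^p_{M^p(\mathbb R^n\times\mathbb R^n,\mathcal L^{2n})}=\sup_{\lambda>0}\lambda^p\,\mathcal L^{2n}(\{(x,y): |g(x,y)|\ge\lambda\})$. *)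

theory Defs
  imports "HOL-Analysis.Analysis"
begin

definition sym_convex_body :: "'a::euclidean_space set \<Rightarrow> bool" where
  "sym_convex_body K \<longleftrightarrow> compact K \<and> convex K \<and> interior K \<noteq> {} \<and> uminus ` K = K"

definition mink :: "'a::euclidean_space set \<Rightarrow> 'a \<Rightarrow> real" where
  "mink K x = Inf {l. l \<ge> 0 \<and> x \<in> (\<lambda>y. l *\<^sub>R y) ` K}"

definition Zp_polar_norm :: "real \<Rightarrow> 'a::euclidean_space set \<Rightarrow> 'a \<Rightarrow> real" where
  "Zp_polar_norm p K z =
     (((real DIM('a) + p) / 2) * integral K (\<lambda>y. \<bar>z \<bullet> y\<bar> powr p)) powr (1 / p)"

coinductive smooth_fun :: "('a::euclidean_space \<Rightarrow> real) \<Rightarrow> bool" where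
  "(\<forall>x. f differentiable (at x)) \<Longrightarrow>
   (\<forall>v. smooth_fun (\<lambda>x. frechet_derivative f (at x) v)) \<Longrightarrow> smooth_fun f"

definition Cc_infty :: "('a::euclidean_space \<Rightarrow> real) \<Rightarrow> bool" where
  "Cc_infty f \<longleftrightarrow> smooth_fun f \<and> compact (closure {x. f x \<noteq> 0})"

definition grad :: "('a::euclidean_space \<Rightarrow> real) \<Rightarrow> 'a \<Rightarrow> 'a" where
  "grad f x = (\<Sum>b\<in>Basis. frechet_derivative f (at x) b *\<^sub>R b)"

definition weak_Lp_pow :: "real \<Rightarrow> ('b::euclidean_space \<Rightarrow> real) \<Rightarrow> ennreal" where
  "weak_Lp_pow p g =
     (SUP l\<in>{0<..}. ennreal (l powr p) * emeasure lborel {z. \<bar>g z\<bar> \<ge> l})"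

end

theory Submission
  imports Defs
begin

text \<open>Write \<open>N\<close> for the norm of \<open>K\<close>, \<open>n\<close> for the dimension and \<open>\<Phi>\<^sub>\<lambda>(h)\<close> for the measure of the
  \<open>x\<close> with \<open>\<bar>f (x + h) - f x\<bar> \<ge> \<lambda> N(h)\<^bsup>n/p+1\<^esup>\<close>, so that the superlevel set has measure
  \<open>\<integral> \<Phi>\<^sub>\<lambda>(h) dh\<close>.

  Upper bound: polar coordinates reduce the integral to a fixed direction \<open>\<theta>\<close>, and translation
  invariance reduces that to a line. On a line, Jensen's inequality shows that every interval
  \<open>[s, s + r]\<close> in the superlevel set satisfies
  \<open>\<integral> \<bar>g'\<bar>\<^sup>p \<ge> \<kappa>\<^sup>p r\<^bsup>n+1\<^esup>\<close> over it, and a Vitali selection of disjoint such intervals bounds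
  the measure.

  Limit: with \<open>h = \<epsilon> u\<close> and \<open>\<epsilon> = \<lambda>\<^bsup>-p/n\<^esup>\<close>, the quantity
  \<open>\<lambda>\<^sup>p \<integral> \<Phi>\<^sub>\<lambda>(h) dh\<close> is the measure of the pairs \<open>(x, u)\<close> with
  \<open>\<bar>f (x + \<epsilon> u) - f x\<bar> / \<epsilon> \<ge> N(u)\<^bsup>n/p+1\<^esup>\<close>. By dominated convergence it tends to the measure
  of the pairs with \<open>\<bar>grad f x \<bullet> u\<bar> \<ge> N(u)\<^bsup>n/p+1\<^esup>\<close>, which polar coordinates evaluate. The lower
  bound follows from the limit.\<close>

section \<open>The norm of a symmetric convex body\<close>

text \<open>The interior inherits symmetry and convexity, so it contains the midpoint of any of its
  points \<open>x\<close> and \<open>- x\<close>.\<close>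

lemma sym_convex_body_zero_interior:
  fixes K :: "'a::euclidean_space set"
  assumes "sym_convex_body K"
  shows "0 \<in> interior K"
proof -
  obtain x where x: "x \<in> interior K"
    using assms by (auto simp: sym_convex_body_def)
  have "uminus ` K = K" using assms by (simp add: sym_convex_body_def)
  then have "uminus ` interior K = interior K"
    by (metis interior_negations)
  then have mx: "- x \<in> interior K" using x by blast
  have "convex (interior K)" using assms by (simp add: sym_convex_body_def convex_interior)
  from convexD[OF this x mx, of "1/2" "1/2"] show ?thesis by simp
qed

locale sym_body =
  fixes K :: "'a::euclidean_space set"
  assumes body: "sym_convex_body K"
begin

abbreviation N :: "'a \<Rightarrow> real" where "N \<equiv> mink K"

lemma K_uminus: "- x \<in> K \<longleftrightarrow> x \<in> K"
proof -
  have "uminus ` K = K" using body by (simp add: sym_convex_body_def)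
  then show ?thesis by (metis imageI minus_minus)
qed

lemma compact_K: "compact K" and convex_K: "convex K" and closed_K: "closed K"
  using body by (auto simp: sym_convex_body_def compact_imp_closed)

lemma zero_in_K: "0 \<in> K"
  using sym_convex_body_zero_interior[OF body] interior_subset by blast

lemma K_scale: "x \<in> K \<Longrightarrow> 0 \<le> t \<Longrightarrow> t \<le> 1 \<Longrightarrow> t *\<^sub>R x \<in> K"
  using convexD_alt[OF convex_K zero_in_K, of x t] by simp

lemma ex_inner: "\<exists>e>0. \<forall>x. norm x \<le> e \<longrightarrow> x \<in> K"
proof -
  obtain e where "e > 0" "cball 0 e \<subseteq> K"
    using sym_convex_body_zero_interior[OF body] mem_interior_cball by blast
  then show ?thesis by (auto simp: subset_iff)
qed

lemma ex_outer: "\<exists>B>0. \<forall>x\<in>K. norm x \<le> B"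
  using compact_K[THEN compact_imp_bounded] bounded_pos by blast

lemma mink_bdd: "bdd_below {l. l \<ge> 0 \<and> x \<in> (\<lambda>y. l *\<^sub>R y) ` K}"
  by (rule bdd_belowI[of _ 0]) auto

lemma mink_nonempty: "{l. l \<ge> 0 \<and> x \<in> (\<lambda>y. l *\<^sub>R y) ` K} \<noteq> {}"
proof -
  obtain e where e: "e > 0" "\<And>x. norm x \<le> e \<Longrightarrow> x \<in> K" using ex_inner by blast
  define l where "l = norm x / e + 1"
  have l: "l > 0" using e by (simp add: l_def add_nonneg_pos)
  have "norm ((1/l) *\<^sub>R x) \<le> e"
    using l e by (simp add: l_def field_simps)
  then have "(1/l) *\<^sub>R x \<in> K" using e by blast
  then have "x \<in> (\<lambda>y. l *\<^sub>R y) ` K"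
    using l by (intro image_eqI[of _ _ "(1/l) *\<^sub>R x"]) auto
  then show ?thesis using l less_imp_le by blast
qed

lemma mink_nonneg: "0 \<le> N x"
  unfolding mink_def by (rule cInf_greatest[OF mink_nonempty]) auto

text \<open>The infimum defining \<open>N\<close> is attained because \<open>K\<close> is closed:
  every \<open>s > r\<close> exceeds an admissible scale, so \<open>x / s\<close> is in
  \<open>K\<close> by shrinking towards \<open>0\<close>, and \<open>s\<close> then decreases to
  \<open>r\<close>. This turns statements about \<open>N\<close> into membership in
  \<open>K\<close>.\<close>

lemma mink_le_iff:
  assumes "r > 0"
  shows "N x \<le> r \<longleftrightarrow> (1 / r) *\<^sub>R x \<in> K"
proof
  assume "(1 / r) *\<^sub>R x \<in> K"
  then have "x \<in> (\<lambda>y. r *\<^sub>R y) ` K"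
    using assms by (intro image_eqI[of _ _ "(1/r) *\<^sub>R x"]) auto
  then show "N x \<le> r"
    unfolding mink_def using assms by (intro cInf_lower mink_bdd) auto
next
  assume le: "N x \<le> r"
  have *: "(1 / s) *\<^sub>R x \<in> K" if "s > r" for s
  proof -
    have "Inf {l. l \<ge> 0 \<and> x \<in> (\<lambda>y. l *\<^sub>R y) ` K} < s"
      using le that by (simp add: mink_def)
    then obtain l y where l: "l \<ge> 0" "l < s" "y \<in> K" "x = l *\<^sub>R y"
      by (auto simp: cInf_less_iff[OF mink_nonempty mink_bdd])
    have "(1 / s) *\<^sub>R x = (l / s) *\<^sub>R y" using l by simp
    also have "\<dots> \<in> K" using l that assms by (intro K_scale) auto
    finally show ?thesis .
  qed
  have "((\<lambda>s. (1 / s) *\<^sub>R x) \<longlongrightarrow> (1 / r) *\<^sub>R x) (at_right r)"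
    using assms by (intro tendsto_intros) auto
  moreover have "\<forall>\<^sub>F s in at_right r. (1 / s) *\<^sub>R x \<in> K"
    using * by (simp add: eventually_at_filter)
  ultimately show "(1 / r) *\<^sub>R x \<in> K"
    using closed_K by (intro Lim_in_closed_set) auto
qed

text \<open>A nonnegative number is determined by the positive thresholds above it. Homogeneity,
  symmetry and the value at \<open>0\<close> thus follow from \<open>mink_le_iff\<close> without
  returning to the infimum.\<close>

lemma mink_eqI: "0 \<le> c \<Longrightarrow> (\<And>r. r > 0 \<Longrightarrow> N x \<le> r \<longleftrightarrow> c \<le> r) \<Longrightarrow> N x = c"
proof (rule antisym)
  assume *: "0 \<le> c" "\<And>r. r > 0 \<Longrightarrow> N x \<le> r \<longleftrightarrow> c \<le> r"
  show "N x \<le> c"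
    by (rule field_le_epsilon) (use * in simp)
  show "c \<le> N x"
    by (rule field_le_epsilon) (use * mink_nonneg[of x] in \<open>simp flip: *(2)\<close>)
qed

lemma mink_scale:
  assumes "c > 0" shows "N (c *\<^sub>R x) = c * N x"
proof (rule mink_eqI)
  show "0 \<le> c * N x" using assms mink_nonneg by simp
  fix r :: real assume r: "r > 0"
  have "N (c *\<^sub>R x) \<le> r \<longleftrightarrow> (1 / (r / c)) *\<^sub>R x \<in> K" using r by (simp add: mink_le_iff)
  also have "\<dots> \<longleftrightarrow> N x \<le> r / c" using r assms by (subst mink_le_iff) auto
  also have "\<dots> \<longleftrightarrow> c * N x \<le> r" using assms by (simp add: field_simps)
  finally show "N (c *\<^sub>R x) \<le> r \<longleftrightarrow> c * N x \<le> r" .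
qed

lemma mink_uminus: "N (- x) = N x"
  by (rule mink_eqI[OF mink_nonneg]) (simp add: mink_le_iff K_uminus)

lemma mink_0 [simp]: "N 0 = 0"
  by (rule mink_eqI) (simp_all add: mink_le_iff zero_in_K)

text \<open>Boundedness of \<open>K\<close> makes \<open>N\<close> dominate the Euclidean norm. This
  yields definiteness, and later confines the rescaled increments to a bounded set.\<close>

lemma ex_norm_le_mink: "\<exists>B>0. \<forall>x. norm x \<le> B * N x"
proof -
  obtain B where B: "B > 0" "\<And>x. x \<in> K \<Longrightarrow> norm x \<le> B" using ex_outer by blast
  have "norm x \<le> B * N x" for x
  proof (rule field_le_epsilon)
    \<comment> \<open>The slack \<open>e\<close> keeps the scale \<open>r\<close> positive even if
      \<open>N x\<close> were \<open>0\<close>, as \<open>mink_le_iff\<close> demands.\<close>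
    fix e :: real assume e: "e > 0"
    define r where "r = N x + e / B"
    have r: "r > 0" "N x \<le> r" using e B mink_nonneg[of x] by (auto simp: r_def add_nonneg_pos)
    then have "norm ((1 / r) *\<^sub>R x) \<le> B" using mink_le_iff B by blast
    then have "norm x \<le> B * r" using r by (simp add: field_simps)
    then show "norm x \<le> B * N x + e" using B by (simp add: r_def algebra_simps)
  qed
  then show ?thesis using B by blast
qed

lemma mink_pos: "x \<noteq> 0 \<Longrightarrow> 0 < N x"
  using ex_norm_le_mink mink_nonneg[of x]
  by (metis less_eq_real_def mult_zero_right norm_le_zero_iff)

lemma mink_measurable [measurable]: "N \<in> borel_measurable borel"
proof (rule borel_measurableI_le)
  fix y :: real
  consider "y < 0" | "y = 0" | "y > 0" by linarith
  then show "{x \<in> space borel. N x \<le> y} \<in> sets borel"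
  proof cases
    case 1
    then have "{x \<in> space borel. N x \<le> y} = {}" using mink_nonneg by (force dest: order_trans)
    then show ?thesis by simp
  next
    case 2
    then have "{x \<in> space borel. N x \<le> y} = {0}" using mink_pos by (auto dest: leD)
    then show ?thesis by simp
  next
    case 3
    then have "{x \<in> space borel. N x \<le> y} = (\<lambda>x. (1 / y) *\<^sub>R x) -` K"
      by (auto simp: mink_le_iff)
    then show ?thesis
      using closed_K by (auto intro!: borel_closed closed_vimage continuous_intros)
  qed
qed

end

section \<open>Polar coordinates\<close>

lemma nn_integral_lborel_affine:
  fixes F :: "'a::euclidean_space \<Rightarrow> ennreal"
  assumes [measurable]: "F \<in> borel_measurable borel" and c: "c \<noteq> 0"
  shows "(\<integral>\<^sup>+x. F x \<partial>lborel) = ennreal (\<bar>c\<bar> ^ DIM('a)) * (\<integral>\<^sup>+x. F (t + c *\<^sub>R x) \<partial>lborel)"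
  by (subst lborel_affine[OF c, of t])
     (simp add: nn_integral_density nn_integral_distr nn_integral_cmult)

lemma nn_integral_lborel_translate:
  fixes F :: "'a::euclidean_space \<Rightarrow> ennreal"
  assumes [measurable]: "F \<in> borel_measurable borel"
  shows "(\<integral>\<^sup>+x. F (t + x) \<partial>lborel) = (\<integral>\<^sup>+x. F x \<partial>lborel)"
  using nn_integral_lborel_affine[OF assms, of 1 t] by simp

text \<open>This normalises the radial density of the polar formula; \<open>- (m / r) powr q\<close>
  is an antiderivative that vanishes at infinity.\<close>

lemma nn_integral_powr_tail:
  assumes "q > 0" "m > 0"
  shows "(\<integral>\<^sup>+r. ennreal (q * m powr q * r powr (- q - 1)) * indicator {m..} r \<partial>lborel) = 1"
proof -
  have "(\<integral>\<^sup>+r. ennreal (q * m powr q * r powr (- q - 1)) * indicator {m..} r \<partial>lborel)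
      = ennreal (0 - (- (m powr q) * m powr (- q)))"
  proof (rule nn_integral_FTC_atLeast[where F="\<lambda>r. - (m powr q) * r powr (- q)" and T=0])
    fix x assume "m \<le> x"
    then have x: "x > 0" using assms by simp
    show "((\<lambda>r. - (m powr q) * r powr (- q)) has_real_derivative q * m powr q * x powr (- q - 1)) (at x)"
      using x by (auto intro!: derivative_eq_intros)
    show "0 \<le> q * m powr q * x powr (- q - 1)" using assms by simp
  next
    have "((\<lambda>r. - (m powr q) * r powr (- q)) \<longlongrightarrow> - (m powr q) * 0) at_top"
      using assms by (intro tendsto_intros tendsto_neg_powr filterlim_ident) auto
    then show "((\<lambda>r. - (m powr q) * r powr (- q)) \<longlongrightarrow> 0) at_top" by simp
  qed auto
  then show ?thesis using assms by (simp flip: powr_add)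
qed

lemma nn_integral_monomial:
  assumes "m \<ge> 0" "d > 0"
  shows "(\<integral>\<^sup>+r. ennreal (r ^ (d - 1)) * indicator {0..m} r \<partial>lborel) = ennreal (m ^ d / real d)"
proof -
  have "(\<integral>\<^sup>+r. ennreal (r ^ (d - 1)) * indicator {0..m} r \<partial>lborel) = ennreal (m ^ d / d - 0 ^ d / d)"
    using assms by (intro nn_integral_FTC_Icc) (auto intro!: derivative_eq_intros)
  then show ?thesis using assms by (simp add: zero_power)
qed

context sym_body
begin

text \<open>Polar coordinates without a surface measure: spread each \<open>h \<noteq> 0\<close> over the radii
  \<open>r \<ge> N h\<close> with the probability density \<open>q (N h)\<^sup>q / r\<^sup>q\<^sup>+\<^sup>1\<close>, exchange
  the integrals and substitute \<open>h = r \<theta>\<close>.\<close>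

lemma nn_integral_polar:
  fixes \<Phi> :: "'a \<Rightarrow> ennreal"
  assumes [measurable]: "\<Phi> \<in> borel_measurable borel" and q: "q > 0"
  shows "(\<integral>\<^sup>+h. \<Phi> h \<partial>lborel) =
    (\<integral>\<^sup>+\<theta>. indicator K \<theta> * ennreal (q * N \<theta> powr q) *
      (\<integral>\<^sup>+r. indicator {0<..} r * ennreal (r ^ (DIM('a) - 1)) * \<Phi> (r *\<^sub>R \<theta>) \<partial>lborel) \<partial>lborel)"
proof -
  have K[measurable]: "K \<in> sets borel" using closed_K by simp
  define G where "G h r = \<Phi> h * (ennreal (q * N h powr q * r powr (- q - 1)) * (if N h \<le> r then 1 else 0))"
    for h and r :: real
  have G[measurable]: "(\<lambda>(h, r). G h r) \<in> borel_measurable (borel \<Otimes>\<^sub>M borel)"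
    unfolding G_def by measurable
  have eq: "\<Phi> h = (\<integral>\<^sup>+r. G h r \<partial>lborel)" if "h \<noteq> 0" for h
  proof -
    have "(\<integral>\<^sup>+r. G h r \<partial>lborel) = 
       (\<integral>\<^sup>+r. \<Phi> h * (ennreal (q * N h powr q * r powr (- q - 1)) * indicator {N h..} r) \<partial>lborel)"
      by (intro nn_integral_cong) (auto simp: G_def split: split_indicator)
    also have "\<dots> = \<Phi> h"
      using nn_integral_powr_tail[OF q mink_pos[OF that]] by (subst nn_integral_cmult) auto
    finally show ?thesis by simp
  qed
  have "(\<integral>\<^sup>+h. \<Phi> h \<partial>lborel) = (\<integral>\<^sup>+h. (\<integral>\<^sup>+r. G h r \<partial>lborel) \<partial>lborel)"
    by (rule nn_integral_cong_AE) (use AE_lborel_singleton[of 0] eq in \<open>auto elim: eventually_mono\<close>)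
  also have "\<dots> = (\<integral>\<^sup>+r. (\<integral>\<^sup>+h. G h r \<partial>lborel) \<partial>lborel)"
    by (rule lborel_pair.Fubini'[symmetric]) simp
  also have "\<dots> = (\<integral>\<^sup>+r. (\<integral>\<^sup>+\<theta>. indicator K \<theta> * ennreal (q * N \<theta> powr q) *
      (indicator {0<..} r * ennreal (r ^ (DIM('a) - 1)) * \<Phi> (r *\<^sub>R \<theta>)) \<partial>lborel) \<partial>lborel)"
  proof (rule nn_integral_cong)
    fix r :: real
    show "(\<integral>\<^sup>+h. G h r \<partial>lborel) = (\<integral>\<^sup>+\<theta>. indicator K \<theta> * ennreal (q * N \<theta> powr q) *
      (indicator {0<..} r * ennreal (r ^ (DIM('a) - 1)) * \<Phi> (r *\<^sub>R \<theta>)) \<partial>lborel)"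
    proof (cases "r > 0")
      case False
      then have "G h r = 0" for h
        \<comment> \<open>Only \<open>h = 0\<close> could satisfy \<open>N h \<le> r\<close> here,
          and there the factor \<open>N h powr q\<close> is zero.\<close>
        using mink_nonneg[of h] q by (cases "h = 0") (auto simp: G_def dest: mink_pos)
      then show ?thesis using False by simp
    next
      case True
      have "(\<integral>\<^sup>+h. G h r \<partial>lborel) = ennreal (r ^ DIM('a)) * (\<integral>\<^sup>+\<theta>. G (r *\<^sub>R \<theta>) r \<partial>lborel)"
        using True by (subst nn_integral_lborel_affine[of _ r 0]) auto
      also have "\<dots> = (\<integral>\<^sup>+\<theta>. ennreal (r ^ DIM('a)) * G (r *\<^sub>R \<theta>) r \<partial>lborel)"
        by (subst nn_integral_cmult) auto
      also have "\<dots> = (\<integral>\<^sup>+\<theta>. indicator K \<theta> * ennreal (q * N \<theta> powr q) *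
      (indicator {0<..} r * ennreal (r ^ (DIM('a) - 1)) * \<Phi> (r *\<^sub>R \<theta>)) \<partial>lborel)"
      proof (rule nn_integral_cong)
        fix \<theta> :: 'a
        \<comment> \<open>After the dilation the constraint on the radius no longer involves
          \<open>r\<close>; it becomes the indicator of \<open>K\<close>.\<close>
        have le: "N (r *\<^sub>R \<theta>) \<le> r \<longleftrightarrow> \<theta> \<in> K"
          using True by (simp add: mink_le_iff)
        have pw: "r ^ DIM('a) * (q * N (r *\<^sub>R \<theta>) powr q * r powr (- q - 1))
            = q * N \<theta> powr q * r ^ (DIM('a) - 1)"
        proof -
          have "r powr q * r powr (- q - 1) = 1 / r"
            using True by (simp add: powr_minus_divide flip: powr_add)
          moreover have "r ^ DIM('a) = r ^ (DIM('a) - 1) * r"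
            using True DIM_positive[where 'a='a] by (metis One_nat_def Suc_pred power_Suc2)
          ultimately show ?thesis
            using True mink_nonneg[of \<theta>] by (simp add: mink_scale powr_mult)
        qed
        have "ennreal (r ^ DIM('a)) * ennreal (q * N (r *\<^sub>R \<theta>) powr q * r powr (- q - 1))
            = ennreal (q * N \<theta> powr q) * ennreal (r ^ (DIM('a) - 1))"
          using True q pw by (simp flip: ennreal_mult)
        then have "ennreal (r ^ DIM('a)) * (\<Phi> (r *\<^sub>R \<theta>) * ennreal (q * N (r *\<^sub>R \<theta>) powr q * r powr (- q - 1)))
            = ennreal (q * N \<theta> powr q) * (ennreal (r ^ (DIM('a) - 1)) * \<Phi> (r *\<^sub>R \<theta>))"
          by (metis mult.assoc mult.commute)
        then show "ennreal (r ^ DIM('a)) * G (r *\<^sub>R \<theta>) r = indicator K \<theta> * ennreal (q * N \<theta> powr q) *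
            (indicator {0<..} r * ennreal (r ^ (DIM('a) - 1)) * \<Phi> (r *\<^sub>R \<theta>))"
          using True by (simp add: G_def le)
      qed
      finally show ?thesis .
    qed
  qed
  also have "\<dots> = (\<integral>\<^sup>+\<theta>. (\<integral>\<^sup>+r. indicator K \<theta> * ennreal (q * N \<theta> powr q) *
      (indicator {0<..} r * ennreal (r ^ (DIM('a) - 1)) * \<Phi> (r *\<^sub>R \<theta>)) \<partial>lborel) \<partial>lborel)"
    by (rule lborel_pair.Fubini') measurable
  also have "\<dots> = (\<integral>\<^sup>+\<theta>. indicator K \<theta> * ennreal (q * N \<theta> powr q) *
      (\<integral>\<^sup>+r. indicator {0<..} r * ennreal (r ^ (DIM('a) - 1)) * \<Phi> (r *\<^sub>R \<theta>) \<partial>lborel) \<partial>lborel)"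
    by (intro nn_integral_cong nn_integral_cmult) measurable
  finally show ?thesis .
qed

end

section \<open>The one-dimensional estimate\<close>

text \<open>Convexity of the power function on the open half-line gives the tangent bound for
  \<open>t > 0\<close>. At \<open>t = 0\<close> it reduces to
  \<open>c powr p \<le> p * c powr p\<close>. It serves as the pointwise form of Jensen's
  inequality.\<close>

lemma powr_above_tangent:
  fixes t c p :: real
  assumes "p \<ge> 1" "c > 0" "t \<ge> 0"
  shows "c powr p + p * c powr (p - 1) * (t - c) \<le> t powr p"
proof (cases "t = 0")
  case True
  have "c powr (p - 1) * c = c powr p"
    using assms powr_mult_base[of c "p - 1"] by (simp add: mult.commute)
  moreover have "c powr p \<le> p * c powr p" using assms by simp
  ultimately show ?thesis using True assms by (simp add: mult.assoc)
next
  case False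
  have "p * c powr (p - 1) * (t - c) \<le> t powr p - c powr p"
  proof (rule convex_on_imp_above_tangent[OF powr_convex])
    show "((\<lambda>x. x powr p) has_real_derivative p * c powr (p - 1)) (at c within {0<..})"
      using assms by (auto intro!: derivative_eq_intros)
  qed (use assms False in \<open>auto simp: interior_open\<close>)
  then show ?thesis by simp
qed

text \<open>This is Jensen's inequality on \<open>[s, s + r]\<close>: the tangent bound at the mean
  slope \<open>c = \<bar>D\<bar> / r\<close> is integrated, with \<open>sgn D\<close> orienting the
  derivative.\<close>

lemma powr_increment_le:
  fixes g g' :: "real \<Rightarrow> real"
  assumes deriv: "\<And>t. (g has_real_derivative g' t) (at t)"
    and cont: "continuous_on UNIV g'" and p: "p \<ge> 1" and r: "r > 0"
  shows "ennreal (\<bar>g (s + r) - g s\<bar> powr p) \<le>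
    ennreal (r powr (p - 1)) * (\<integral>\<^sup>+t. indicator {s..s+r} t * ennreal (\<bar>g' t\<bar> powr p) \<partial>lborel)"
proof -
  define D where "D = g (s + r) - g s"
  define c where "c = \<bar>D\<bar> / r"
  show ?thesis
  proof (cases "D = 0")
    case True
    then show ?thesis by (simp flip: D_def)
  next
    case False
    then have c: "c > 0" using r by (simp add: c_def)
    have cont': "continuous_on {s..s+r} g'" using cont continuous_on_subset by blast
    have i1: "(g' has_integral D) {s..s+r}"
      unfolding D_def using r deriv
      by (intro fundamental_theorem_of_calculus)
        (auto simp: has_real_derivative_iff_has_vector_derivative[symmetric] intro: DERIV_subset)
    have "((\<lambda>t. p * c powr (p - 1) * (sgn D * g' t - c) + c powr p) has_integral
        p * c powr (p - 1) * (sgn D * D - c * r) + c powr p * r) {s..s+r}"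
      using r has_integral_const_real[of c s "s+r"] has_integral_const_real[of "c powr p" s "s+r"]
      by (intro has_integral_add has_integral_mult_right has_integral_diff i1) (auto simp: mult.commute)
    \<comment> \<open>The choice of \<open>c\<close> as the mean slope makes the linear term
      integrate to zero.\<close>
    moreover have "sgn D * D - c * r = 0" using r by (simp add: c_def sgn_if)
    ultimately have i2: "((\<lambda>t. p * c powr (p - 1) * (sgn D * g' t - c) + c powr p) has_integral c powr p * r) {s..s+r}"
      by simp
    have cp: "continuous_on {s..s+r} (\<lambda>t. \<bar>g' t\<bar> powr p)"
      using p by (intro continuous_on_powr' continuous_intros cont') auto
    have i3: "((\<lambda>t. \<bar>g' t\<bar> powr p) has_integral integral {s..s+r} (\<lambda>t. \<bar>g' t\<bar> powr p)) {s..s+r}"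
      using integrable_continuous_real[OF cp] by blast
    have le: "c powr p * r \<le> integral {s..s+r} (\<lambda>t. \<bar>g' t\<bar> powr p)"
    proof (rule has_integral_le[OF i2 i3])
      fix t
      have "p * c powr (p - 1) * (sgn D * g' t - c) \<le> p * c powr (p - 1) * (\<bar>g' t\<bar> - c)"
        using p by (intro mult_left_mono) (auto simp: sgn_if)
      also have "\<dots> \<le> \<bar>g' t\<bar> powr p - c powr p"
        using powr_above_tangent[OF p c, of "\<bar>g' t\<bar>"] by simp
      finally show "p * c powr (p - 1) * (sgn D * g' t - c) + c powr p \<le> \<bar>g' t\<bar> powr p" by simp
    qed
    have [measurable]: "g' \<in> borel_measurable borel" using cont by (rule borel_measurable_continuous_onI)
    have "((\<lambda>t. if t \<in> {s..s+r} then \<bar>g' t\<bar> powr p else 0) has_integral integral {s..s+r} (\<lambda>t. \<bar>g' t\<bar> powr p)) UNIV"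
      using i3 by (simp only: has_integral_restrict_UNIV)
    then have "(\<integral>\<^sup>+t. ennreal (if t \<in> {s..s+r} then \<bar>g' t\<bar> powr p else 0) \<partial>lborel)
        = ennreal (integral {s..s+r} (\<lambda>t. \<bar>g' t\<bar> powr p))"
      by (intro nn_integral_has_integral_lborel) auto
    also have "(\<integral>\<^sup>+t. ennreal (if t \<in> {s..s+r} then \<bar>g' t\<bar> powr p else 0) \<partial>lborel)
       = (\<integral>\<^sup>+t. indicator {s..s+r} t * ennreal (\<bar>g' t\<bar> powr p) \<partial>lborel)"
      by (intro nn_integral_cong) (auto split: split_indicator)
    finally have eq: "(\<integral>\<^sup>+t. indicator {s..s+r} t * ennreal (\<bar>g' t\<bar> powr p) \<partial>lborel)
        = ennreal (integral {s..s+r} (\<lambda>t. \<bar>g' t\<bar> powr p))" .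
    have "\<bar>D\<bar> powr p = (c * r) powr p" using r by (simp add: c_def)
    also have "\<dots> = r powr (p - 1) * (c powr p * r)"
      using r c powr_mult_base[of r "p - 1"] by (simp add: powr_mult mult.commute mult.left_commute)
    also have "\<dots> \<le> r powr (p - 1) * integral {s..s+r} (\<lambda>t. \<bar>g' t\<bar> powr p)"
      by (intro mult_left_mono le) auto
    finally have "\<bar>D\<bar> powr p \<le> r powr (p - 1) * integral {s..s+r} (\<lambda>t. \<bar>g' t\<bar> powr p)" .
    then show ?thesis unfolding eq by (simp add: D_def ennreal_leI flip: ennreal_mult')
  qed
qed


section \<open>Vitali selection of intervals on a line\<close>

lemma nn_integral_count_space_disjoint_le:
  assumes "\<And>i j. i \<in> C \<Longrightarrow> j \<in> C \<Longrightarrow> i \<noteq> j \<Longrightarrow> disjnt (A i) (A j)"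
    and "\<And>i. i \<in> C \<Longrightarrow> A i \<subseteq> B"
  shows "(\<integral>\<^sup>+i. indicator (A i) t \<partial>count_space C) \<le> (indicator B t :: ennreal)"
proof (cases "\<exists>j\<in>C. t \<in> A j")
  case True
  then obtain j where j: "j \<in> C" "t \<in> A j" by blast
  have "(\<integral>\<^sup>+i. indicator (A i) t \<partial>count_space C) = (\<integral>\<^sup>+i. 1 * indicator {j} i \<partial>count_space C)"
    using j assms(1)[OF j(1)] 
    by (intro nn_integral_cong) (auto simp: disjnt_iff split: split_indicator)
  also have "\<dots> = 1" using j by (subst nn_integral_indicator_singleton) auto
  finally show ?thesis using j assms(2) by (auto simp: subset_iff split: split_indicator)
next
  case False
  then have "(\<integral>\<^sup>+i. indicator (A i) t \<partial>count_space C) = (\<integral>\<^sup>+i. 0 \<partial>count_space C)"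
    by (intro nn_integral_cong) (auto split: split_indicator)
  then show ?thesis by simp
qed

lemma cball_half: "cball (s + r / 2) (r / 2) = {s..s + r :: real}"
  by (simp add: cball_eq_atLeastAtMost)

text \<open>Let \<open>S\<close> be the set of admissible pairs. A disjoint Vitali family
  \<open>C\<close> of intervals \<open>[s, s + r]\<close> from \<open>S\<close> is chosen so that
  the boxes \<open>B j\<close> times \<open>[0, R j]\<close> cover \<open>S\<close>. Each box has
  weighted area at most \<open>(5 * snd j) ^ (d + 1)\<close>, which \<open>S1\<close> bounds by the
  energy of \<open>g'\<close> on the selected interval \<open>A j\<close>. Disjointness inside
  \<open>[0, 2 T]\<close> lets these energies be summed.\<close>

lemma line_estimate:
  fixes g g' :: "real \<Rightarrow> real" and d :: nat
  assumes deriv: "\<And>t. (g has_real_derivative g' t) (at t)"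
    and cont: "continuous_on UNIV g'" and p: "p \<ge> 1" and T: "T > 0" and \<kappa>: "\<kappa> > 0" and d: "d > 0"
  shows "(\<integral>\<^sup>+s. indicator {0..T} s * (\<integral>\<^sup>+r. indicator {0<..T} r * ennreal (r ^ (d - 1)) *
            indicator {r. \<kappa> * r powr (real d / p + 1) \<le> \<bar>g (s + r) - g s\<bar>} r \<partial>lborel) \<partial>lborel)
     \<le> ennreal (5 ^ (d + 1) / \<kappa> powr p) *
        (\<integral>\<^sup>+t. indicator {0..2*T} t * ennreal (\<bar>g' t\<bar> powr p) \<partial>lborel)"
proof -
  have [measurable]: "g' \<in> borel_measurable borel" using cont by (rule borel_measurable_continuous_onI)
  define S where "S = {(s, r). 0 \<le> s \<and> s \<le> T \<and> 0 < r \<and> r \<le> T \<and>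
    \<kappa> * r powr (real d / p + 1) \<le> \<bar>g (s + r) - g s\<bar>}"
  define U where "U s r = (\<integral>\<^sup>+t. indicator {s..s+r} t * ennreal (\<bar>g' t\<bar> powr p) \<partial>lborel)" for s r
  \<comment> \<open>Raising the defining inequality to the power \<open>p\<close> gives
    \<open>r powr (d + p)\<close>, and Jensen costs \<open>r powr (p - 1)\<close>; the quotient is
    \<open>r ^ (d + 1)\<close>, whatever \<open>p\<close> is.\<close>
  have S1: "ennreal (\<kappa> powr p * r ^ (d + 1)) \<le> U s r" if "(s, r) \<in> S" for s r
  proof -
    have r: "r > 0" and le: "\<kappa> * r powr (real d / p + 1) \<le> \<bar>g (s + r) - g s\<bar>"
      using that by (auto simp: S_def)
    have e: "(real d / p + 1) * p = real d + p" using p by (simp add: field_simps)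
    have "\<kappa> powr p * r powr (real d + p) = (\<kappa> * r powr (real d / p + 1)) powr p"
      using r \<kappa> by (simp add: powr_mult powr_powr e)
    also have "\<dots> \<le> \<bar>g (s + r) - g s\<bar> powr p"
      using le r \<kappa> p by (intro powr_mono2) auto
    finally have "ennreal (\<kappa> powr p * r powr (real d + p)) \<le> ennreal (r powr (p - 1)) * U s r"
      using powr_increment_le[OF deriv cont p r, of s] order_trans[OF ennreal_leI] unfolding U_def by blast
    then have "ennreal (r powr (1 - p)) * ennreal (\<kappa> powr p * r powr (real d + p)) \<le>
        ennreal (r powr (1 - p)) * (ennreal (r powr (p - 1)) * U s r)"
      by (rule mult_left_mono) simp
    moreover have "ennreal (r powr (1 - p)) * (ennreal (r powr (p - 1)) * U s r) = U s r"
      using r by (simp add: mult.assoc[symmetric] flip: ennreal_mult powr_add)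
    moreover have "r powr (1 - p) * (\<kappa> powr p * r powr (real d + p)) = \<kappa> powr p * r ^ (d + 1)"
    proof -
      have "r powr (1 - p) * r powr (real d + p) = r powr real (d + 1)"
        by (simp add: algebra_simps flip: powr_add)
      also have "\<dots> = r ^ (d + 1)" using r by (rule powr_realpow)
      finally show ?thesis by simp
    qed
    ultimately show ?thesis by (simp flip: ennreal_mult)
  qed
  have bd: "0 < snd i / 2 \<and> snd i / 2 \<le> T" if "i \<in> S" for i
    using that T by (auto simp: S_def)
  obtain C where C: "countable C" "C \<subseteq> S"
      "pairwise (\<lambda>i j. disjnt (cball (fst i + snd i / 2) (snd i / 2)) (cball (fst j + snd j / 2) (snd j / 2))) C"
      and cov: "\<And>i. i \<in> S \<Longrightarrow> \<exists>j. j \<in> C \<and>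
         \<not> disjnt (cball (fst i + snd i / 2) (snd i / 2)) (cball (fst j + snd j / 2) (snd j / 2)) \<and>
         cball (fst i + snd i / 2) (snd i / 2) \<subseteq> ball (fst j + snd j / 2) (5 * (snd j / 2))"
    by (rule Vitali_covering_lemma_cballs_balls[OF bd, where a="\<lambda>i. fst i + snd i / 2"]) blast+
  define A where "A j = {fst j..fst j + snd j}" for j :: "real \<times> real"
  \<comment> \<open>\<open>B j\<close> is \<open>A j\<close> enlarged five times about its midpoint,
    and \<open>R j\<close> is its length.\<close>
  define B where "B j = {fst j - 2 * snd j..fst j + 3 * snd j}" for j :: "real \<times> real"
  define R where "R j = 5 * snd j" for j :: "real \<times> real"
  have dis: "disjnt (A i) (A j)" if "i \<in> C" "j \<in> C" "i \<noteq> j" for i j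
    using C(3) that unfolding pairwise_def A_def cball_half by blast
  have sub: "A j \<subseteq> {0..2*T}" if "j \<in> C" for j
    using that C(2) by (auto simp: A_def S_def)
  \<comment> \<open>Both endpoints \<open>s\<close> and \<open>s + r\<close> lie in the enlarged
    interval, so \<open>s\<close> is in \<open>B j\<close> and the length \<open>r\<close> is at
    most \<open>R j\<close>.\<close>
  have cover: "\<exists>j\<in>C. s \<in> B j \<and> r \<le> R j" if sr: "(s, r) \<in> S" for s r
  proof -
    obtain j where j: "j \<in> C" "{s..s+r} \<subseteq> ball (fst j + snd j / 2) (5 * (snd j / 2))"
      using cov[OF sr] by (auto simp: cball_half)
    have "r > 0" using sr by (auto simp: S_def)
    then have "s \<in> ball (fst j + snd j / 2) (5 * (snd j / 2))" "s + r \<in> ball (fst j + snd j / 2) (5 * (snd j / 2))"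
      using j(2) by (auto simp: subset_iff)
    then have "\<bar>fst j + snd j / 2 - s\<bar> < 5 * snd j / 2" "\<bar>fst j + snd j / 2 - (s + r)\<bar> < 5 * snd j / 2"
      by (simp_all only: mem_ball dist_real_def times_divide_eq_right)
    then have "s \<in> B j" "r \<le> R j"
      unfolding B_def R_def atLeastAtMost_iff by (linarith, linarith)
    then show ?thesis using j(1) by blast
  qed
  have R0: "R j \<ge> 0" "snd j > 0" if "j \<in> C" for j
    using that C(2) by (auto simp: R_def S_def)
  \<comment> \<open>Union bound: the indicator of \<open>S\<close> is at most the sum over
    \<open>C\<close> of the indicators of the covering boxes. Countability of \<open>C\<close> then
    permits the interchanges of sum and integral.\<close>
  have "(\<integral>\<^sup>+s. indicator {0..T} s * (\<integral>\<^sup>+r. indicator {0<..T} r * ennreal (r ^ (d - 1)) *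
            indicator {r. \<kappa> * r powr (real d / p + 1) \<le> \<bar>g (s + r) - g s\<bar>} r \<partial>lborel) \<partial>lborel)
     \<le> (\<integral>\<^sup>+s. (\<integral>\<^sup>+r. (\<integral>\<^sup>+j. indicator (B j) s * (ennreal (r ^ (d - 1)) * indicator {0..R j} r)
          \<partial>count_space C) \<partial>lborel) \<partial>lborel)"
    (is "?lhs \<le> _")
  proof (rule nn_integral_mono)
    fix s :: real
    show "indicator {0..T} s * (\<integral>\<^sup>+r. indicator {0<..T} r * ennreal (r ^ (d - 1)) *
            indicator {r. \<kappa> * r powr (real d / p + 1) \<le> \<bar>g (s + r) - g s\<bar>} r \<partial>lborel)
       \<le> (\<integral>\<^sup>+r. (\<integral>\<^sup>+j. indicator (B j) s * (ennreal (r ^ (d - 1)) * indicator {0..R j} r)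
          \<partial>count_space C) \<partial>lborel)"
    proof (cases "s \<in> {0..T}")
      case True
      have "(\<integral>\<^sup>+r. indicator {0<..T} r * ennreal (r ^ (d - 1)) *
            indicator {r. \<kappa> * r powr (real d / p + 1) \<le> \<bar>g (s + r) - g s\<bar>} r \<partial>lborel)
       \<le> (\<integral>\<^sup>+r. (\<integral>\<^sup>+j. indicator (B j) s * (ennreal (r ^ (d - 1)) * indicator {0..R j} r)
          \<partial>count_space C) \<partial>lborel)"
      proof (rule nn_integral_mono)
        fix r :: real
        show "indicator {0<..T} r * ennreal (r ^ (d - 1)) *
            indicator {r. \<kappa> * r powr (real d / p + 1) \<le> \<bar>g (s + r) - g s\<bar>} r
          \<le> (\<integral>\<^sup>+j. indicator (B j) s * (ennreal (r ^ (d - 1)) * indicator {0..R j} r) \<partial>count_space C)"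
        proof (cases "(s, r) \<in> S")
          case in_S: True
          then obtain j where j: "j \<in> C" "s \<in> B j" "r \<le> R j" using cover by blast
          have "indicator {0<..T} r * ennreal (r ^ (d - 1)) *
              indicator {r. \<kappa> * r powr (real d / p + 1) \<le> \<bar>g (s + r) - g s\<bar>} r
            \<le> indicator (B j) s * (ennreal (r ^ (d - 1)) * indicator {0..R j} r)"
            using j in_S by (auto simp: S_def)
          also have "\<dots> \<le> (\<integral>\<^sup>+j. indicator (B j) s * (ennreal (r ^ (d - 1)) * indicator {0..R j} r) \<partial>count_space C)"
            using j(1) by (rule nn_integral_ge_point)
          finally show ?thesis .
        next
          case False
          then have z: "indicator {0<..T} r * ennreal (r ^ (d - 1)) *
            indicator {r. \<kappa> * r powr (real d / p + 1) \<le> \<bar>g (s + r) - g s\<bar>} r = 0"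
            using True by (auto simp: S_def split: split_indicator)
          show ?thesis unfolding z by (rule zero_le)
        qed
      qed
      then show ?thesis using True by simp
    qed simp
  qed
  also have "\<dots> = (\<integral>\<^sup>+s. (\<integral>\<^sup>+j. indicator (B j) s * ennreal (R j ^ d / d) \<partial>count_space C) \<partial>lborel)"
  proof (rule nn_integral_cong)
    fix s :: real
    have "(\<integral>\<^sup>+r. (\<integral>\<^sup>+j. indicator (B j) s * (ennreal (r ^ (d - 1)) * indicator {0..R j} r)
          \<partial>count_space C) \<partial>lborel) = 
       (\<integral>\<^sup>+j. (\<integral>\<^sup>+r. indicator (B j) s * (ennreal (r ^ (d - 1)) * indicator {0..R j} r)
          \<partial>lborel) \<partial>count_space C)"
      by (rule nn_integral_count_space_nn_integral[OF C(1)]) measurable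
    also have "\<dots> = (\<integral>\<^sup>+j. indicator (B j) s * ennreal (R j ^ d / d) \<partial>count_space C)"
    proof (intro nn_integral_cong)
      fix j assume "j \<in> space (count_space C)"
      then have "R j \<ge> 0" using R0 by simp
      then show "(\<integral>\<^sup>+r. indicator (B j) s * (ennreal (r ^ (d - 1)) * indicator {0..R j} r) \<partial>lborel)
        = indicator (B j) s * ennreal (R j ^ d / d)"
        by (subst nn_integral_cmult) (measurable, simp only: nn_integral_monomial[OF _ d])
    qed
    finally show "(\<integral>\<^sup>+r. (\<integral>\<^sup>+j. indicator (B j) s * (ennreal (r ^ (d - 1)) * indicator {0..R j} r)
          \<partial>count_space C) \<partial>lborel) = (\<integral>\<^sup>+j. indicator (B j) s * ennreal (R j ^ d / d) \<partial>count_space C)" .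
  qed
  also have "\<dots> = (\<integral>\<^sup>+j. (\<integral>\<^sup>+s. indicator (B j) s * ennreal (R j ^ d / d) \<partial>lborel) \<partial>count_space C)"
    by (rule nn_integral_count_space_nn_integral[OF C(1)]) (simp add: B_def)
  also have "\<dots> \<le> (\<integral>\<^sup>+j. ennreal (5 ^ (d + 1) / \<kappa> powr p) * U (fst j) (snd j) \<partial>count_space C)"
  proof (rule nn_integral_mono)
    fix j assume "j \<in> space (count_space C)"
    then have j: "j \<in> C" by simp
    \<comment> \<open>The length of \<open>B j\<close> supplies the extra factor \<open>R j\<close>;
      the factor \<open>1 / d\<close> is then discarded.\<close>
    have "(\<integral>\<^sup>+s. indicator (B j) s * ennreal (R j ^ d / d) \<partial>lborel) = ennreal (R j) * ennreal (R j ^ d / d)"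
      using R0[OF j] by (subst nn_integral_multc) (auto simp: B_def R_def)
    also have "\<dots> = ennreal (R j ^ (d + 1) / d)"
      using R0[OF j] by (simp flip: ennreal_mult)
    also have "\<dots> \<le> ennreal (R j ^ (d + 1))"
      using R0[OF j] d zero_le_power[of "R j" "d + 1"] divide_left_mono[of 1 "real d" "R j ^ (d + 1)"]
      by (intro ennreal_leI) simp
    also have "R j ^ (d + 1) = 5 ^ (d + 1) / \<kappa> powr p * (\<kappa> powr p * snd j ^ (d + 1))"
      using \<kappa> by (simp add: R_def power_mult_distrib)
    also have "ennreal \<dots> = ennreal (5 ^ (d + 1) / \<kappa> powr p) * ennreal (\<kappa> powr p * snd j ^ (d + 1))"
      using R0[OF j] by (intro ennreal_mult) auto
    also have "\<dots> \<le> ennreal (5 ^ (d + 1) / \<kappa> powr p) * U (fst j) (snd j)"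
      using S1[of "fst j" "snd j"] j C(2) by (intro mult_left_mono) auto
    finally show "(\<integral>\<^sup>+s. indicator (B j) s * ennreal (R j ^ d / d) \<partial>lborel)
      \<le> ennreal (5 ^ (d + 1) / \<kappa> powr p) * U (fst j) (snd j)" .
  qed
  also have "\<dots> = ennreal (5 ^ (d + 1) / \<kappa> powr p) * (\<integral>\<^sup>+j. U (fst j) (snd j) \<partial>count_space C)"
    by (rule nn_integral_cmult) simp
  also have "(\<integral>\<^sup>+j. U (fst j) (snd j) \<partial>count_space C)
    = (\<integral>\<^sup>+t. (\<integral>\<^sup>+j. indicator (A j) t * ennreal (\<bar>g' t\<bar> powr p) \<partial>count_space C) \<partial>lborel)"
    unfolding U_def A_def
    by (rule nn_integral_count_space_nn_integral[OF C(1), symmetric]) measurable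
  also have "\<dots> = (\<integral>\<^sup>+t. (\<integral>\<^sup>+j. indicator (A j) t \<partial>count_space C) * ennreal (\<bar>g' t\<bar> powr p) \<partial>lborel)"
    by (intro nn_integral_cong nn_integral_multc) simp
  also have "\<dots> \<le> (\<integral>\<^sup>+t. indicator {0..2*T} t * ennreal (\<bar>g' t\<bar> powr p) \<partial>lborel)"
    by (intro nn_integral_mono mult_right_mono nn_integral_count_space_disjoint_le dis sub) auto
  finally show ?thesis by (simp add: mult_left_mono)
qed

section \<open>Test functions and superlevel sets\<close>

lemma has_derivative_grad:
  fixes f :: "'a::euclidean_space \<Rightarrow> real"
  assumes "f differentiable (at x)"
  shows "(f has_derivative (\<lambda>v. grad f x \<bullet> v)) (at x)"
proof -
  have D: "(f has_derivative frechet_derivative f (at x)) (at x)"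
    using assms frechet_derivative_works by blast
  interpret linear "frechet_derivative f (at x)"
    using D by (rule has_derivative_linear)
  have eq: "grad f x \<bullet> v = frechet_derivative f (at x) v" for v
  proof -
    have "frechet_derivative f (at x) v = frechet_derivative f (at x) (\<Sum>b\<in>Basis. (v \<bullet> b) *\<^sub>R b)"
      by (simp add: euclidean_representation)
    also have "\<dots> = (\<Sum>b\<in>Basis. (v \<bullet> b) * frechet_derivative f (at x) b)"
      by (simp add: sum scale)
    also have "\<dots> = grad f x \<bullet> v"
      unfolding grad_def inner_sum_left inner_scaleR_left
      by (intro sum.cong refl) (simp add: inner_commute)
    finally show ?thesis by simp
  qed
  show "(f has_derivative (\<lambda>v. grad f x \<bullet> v)) (at x)"
    using D by (simp add: eq)
qed

lemma Cc_infty_differentiable: "Cc_infty f \<Longrightarrow> f differentiable (at x)"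
  unfolding Cc_infty_def by (auto elim: smooth_fun.cases)

lemma Cc_infty_continuous_on: "Cc_infty f \<Longrightarrow> continuous_on A f"
  by (meson Cc_infty_differentiable continuous_at_imp_continuous_on differentiable_imp_continuous_within)

lemma Cc_infty_continuous_on_grad:
  assumes "Cc_infty f" shows "continuous_on A (grad f)"
proof -
  have sm: "smooth_fun (\<lambda>x. frechet_derivative f (at x) v)" for v
    using assms unfolding Cc_infty_def by (auto elim: smooth_fun.cases)
  have "(\<lambda>x. frechet_derivative f (at x) v) differentiable (at x)" for v x
    using sm[of v] by (auto elim: smooth_fun.cases)
  then have "continuous_on A (\<lambda>x. frechet_derivative f (at x) v)" for v
    by (meson continuous_at_imp_continuous_on differentiable_imp_continuous_within)
  then show ?thesis
    unfolding grad_def by (intro continuous_intros)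
qed

lemma Cc_infty_support:
  assumes "Cc_infty f"
  obtains R where "R > 0" "\<And>x. norm x > R \<Longrightarrow> f x = 0"
proof -
  have "bounded (closure {x. f x \<noteq> 0})"
    using assms unfolding Cc_infty_def by (auto dest: compact_imp_bounded)
  then have "bounded {x. f x \<noteq> 0}" using bounded_subset closure_subset by blast
  then obtain R where "R > 0" "\<forall>x\<in>{x. f x \<noteq> 0}. norm x \<le> R" by (auto simp: bounded_pos)
  then show thesis by (intro that[of R]) force+
qed

lemma Cc_infty_bounded_grad:
  assumes f: "Cc_infty f"
  obtains L where "L > 0" "\<And>x. norm (grad f x) \<le> L"
proof -
  obtain R where R: "R > 0" "\<And>x. norm x > R \<Longrightarrow> f x = 0" using Cc_infty_support[OF f] by blast
  have "compact (grad f ` cball 0 R)"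
    by (intro compact_continuous_image Cc_infty_continuous_on_grad f compact_cball)
  then obtain L where L: "L > 0" "\<And>x. norm x \<le> R \<Longrightarrow> norm (grad f x) \<le> L"
    by (auto simp: bounded_pos dest!: compact_imp_bounded)
  \<comment> \<open>Outside the ball \<open>f\<close> vanishes on a whole neighbourhood of
    \<open>x\<close>, so uniqueness of the derivative forces the gradient to be zero.\<close>
  have "grad f x = 0" if "norm x > R" for x
  proof -
    have "open {y::'a. R < norm y}"
      by (intro open_Collect_less continuous_intros)
    from has_derivative_transform_within_open[OF has_derivative_grad[OF Cc_infty_differentiable[OF f]] this]
    have "((\<lambda>v. 0) has_derivative (\<lambda>v. grad f x \<bullet> v)) (at x)"
      using R that by auto
    moreover have "((\<lambda>v. 0 :: real) has_derivative (\<lambda>v. 0)) (at x)" by simp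
    ultimately have "(\<lambda>v. grad f x \<bullet> v) = (\<lambda>v. 0)" by (rule has_derivative_unique)
    then show ?thesis by (metis inner_eq_zero_iff)
  qed
  then show thesis using L by (intro that[of L]) (metis norm_zero less_imp_le not_le)+
qed

lemma Cc_infty_line_derivative:
  assumes "Cc_infty f"
  shows "((\<lambda>t. f (x + t *\<^sub>R v)) has_real_derivative grad f (x + t *\<^sub>R v) \<bullet> v) (at t)"
proof -
  have "((\<lambda>t. f (x + t *\<^sub>R v)) has_derivative (\<lambda>s. grad f (x + t *\<^sub>R v) \<bullet> (s *\<^sub>R v))) (at t)"
    by (rule has_derivative_compose[OF _ has_derivative_grad[OF Cc_infty_differentiable[OF assms]],
        where f="\<lambda>t. x + t *\<^sub>R v"]) (auto intro!: derivative_eq_intros)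
  then show ?thesis by (simp add: has_field_derivative_def mult.commute[of _ "grad f _ \<bullet> v"])
qed

lemma Cc_infty_lipschitz:
  assumes f: "Cc_infty f" and L: "\<And>x. norm (grad f x) \<le> L"
  shows "\<bar>f (x + v) - f x\<bar> \<le> L * norm v"
proof -
  obtain t where "f (x + 1 *\<^sub>R v) - f (x + 0 *\<^sub>R v) = (1 - 0) * (grad f (x + t *\<^sub>R v) \<bullet> v)"
    using MVT2[of 0 1 "\<lambda>t. f (x + t *\<^sub>R v)" "\<lambda>t. grad f (x + t *\<^sub>R v) \<bullet> v"]
      Cc_infty_line_derivative[OF f] by auto
  then have "\<bar>f (x + v) - f x\<bar> \<le> norm (grad f (x + t *\<^sub>R v)) * norm v"
    using Cauchy_Schwarz_ineq2 by simp
  then show ?thesis using L mult_right_mono norm_ge_zero order_trans by blast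
qed

lemma Cc_infty_bounded:
  assumes f: "Cc_infty f"
  obtains M where "M > 0" "\<And>x. \<bar>f x\<bar> \<le> M"
proof -
  obtain R where R: "R > 0" "\<And>x. norm x > R \<Longrightarrow> f x = 0" using Cc_infty_support[OF f] by blast
  have "compact (f ` cball 0 R)"
    by (intro compact_continuous_image Cc_infty_continuous_on f compact_cball)
  then obtain M where M: "M > 0" "\<And>x. norm x \<le> R \<Longrightarrow> \<bar>f x\<bar> \<le> M"
    by (auto simp: bounded_pos dest!: compact_imp_bounded)
  then show thesis using R by (intro that[of M]) (metis abs_zero less_imp_le not_le)+
qed

section \<open>Superlevel sets in terms of increments, and the moment integral\<close>

locale body_fun = sym_body K for K :: "'a::euclidean_space set" +
  fixes f :: "'a \<Rightarrow> real" and p :: real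
  assumes f: "Cc_infty f" and p: "1 \<le> p"
begin

lemma f_measurable [measurable]: "f \<in> borel_measurable borel"
  using Cc_infty_continuous_on[OF f] by (rule borel_measurable_continuous_onI)

lemma grad_measurable [measurable]: "grad f \<in> borel_measurable borel"
  using Cc_infty_continuous_on_grad[OF f] by (rule borel_measurable_continuous_onI)

lemma K_measurable [measurable]: "K \<in> sets borel"
  using closed_K by simp

lemma exponent_pos: "real DIM('a) / p + 1 > 0" using p by (simp add: add_nonneg_pos)

lemma exponent_times_p: "(real DIM('a) / p + 1) * p = real DIM('a) + p"
  using p by (simp add: field_simps)

text \<open>The superlevel condition at the pair \<open>(x, x + h)\<close>, multiplied out to avoid
  the quotient. At \<open>h = 0\<close> both sides of the inequality would be \<open>0\<close>, so
  the diagonal has to be excluded explicitly.\<close>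

definition large_inc :: "real \<Rightarrow> 'a \<Rightarrow> 'a \<Rightarrow> bool" where
  "large_inc l x h \<longleftrightarrow> h \<noteq> 0 \<and> l * N h powr (real DIM('a) / p + 1) \<le> \<bar>f (x + h) - f x\<bar>"

lemma large_inc_measurable [measurable (raw)]:
  assumes [measurable]: "X \<in> borel_measurable M" "H \<in> borel_measurable M"
  shows "Measurable.pred M (\<lambda>w. large_inc l (X w) (H w))"
  unfolding large_inc_def by measurable

text \<open>The unnormalised \<open>p\<close>-th moment of \<open>K\<close> in direction
  \<open>z\<close>, kept as an extended nonnegative integral so that Tonelli's theorem applies
  directly.\<close>

definition W :: "'a \<Rightarrow> ennreal" where
  "W z = (\<integral>\<^sup>+\<theta>. indicator K \<theta> * ennreal (\<bar>z \<bullet> \<theta>\<bar> powr p) \<partial>lborel)"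

text \<open>Continuity on the compact \<open>K\<close> makes the gauge integral agree with the
  Lebesgue integral \<open>W z\<close>; its nonnegativity lets the outer power cancel the
  \<open>p\<close>-th root.\<close>

lemma Zp_polar_norm_powr:
  "ennreal (Zp_polar_norm p K z powr p) = ennreal ((real DIM('a) + p) / 2) * W z"
proof -
  have c: "continuous_on K (\<lambda>y. \<bar>z \<bullet> y\<bar> powr p)"
    using p by (intro continuous_on_powr' continuous_intros) auto
  have "set_integrable lborel K (\<lambda>y. \<bar>z \<bullet> y\<bar> powr p)"
    by (rule borel_integrable_compact[OF compact_K c, folded set_integrable_def[unfolded scaleR_conv_of_real, simplified]])
  then have int: "(\<lambda>y. \<bar>z \<bullet> y\<bar> powr p) integrable_on K"
    by (rule set_borel_integral_eq_integral)
  then have "((\<lambda>y. if y \<in> K then \<bar>z \<bullet> y\<bar> powr p else 0) has_integral integral K (\<lambda>y. \<bar>z \<bullet> y\<bar> powr p)) UNIV"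
    by (simp only: has_integral_restrict_UNIV has_integral_integral)
  then have "(\<integral>\<^sup>+y. ennreal (if y \<in> K then \<bar>z \<bullet> y\<bar> powr p else 0) \<partial>lborel) = ennreal (integral K (\<lambda>y. \<bar>z \<bullet> y\<bar> powr p))"
    by (intro nn_integral_has_integral_lborel) auto
  also have "(\<integral>\<^sup>+y. ennreal (if y \<in> K then \<bar>z \<bullet> y\<bar> powr p else 0) \<partial>lborel) = W z"
    unfolding W_def by (intro nn_integral_cong) (auto split: split_indicator)
  finally have W: "W z = ennreal (integral K (\<lambda>y. \<bar>z \<bullet> y\<bar> powr p))" .
  have nn: "0 \<le> integral K (\<lambda>y. \<bar>z \<bullet> y\<bar> powr p)" using int by (rule integral_nonneg) simp
  then have zp: "Zp_polar_norm p K z powr p = (real DIM('a) + p) / 2 * integral K (\<lambda>y. \<bar>z \<bullet> y\<bar> powr p)"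
    using p by (simp add: Zp_polar_norm_def powr_powr)
  then show ?thesis
    using p nn unfolding W zp by (intro ennreal_mult) auto
qed

lemma W_measurable [measurable]: "W \<in> borel_measurable borel"
  unfolding W_def by measurable

text \<open>Tonelli, the substitution \<open>y = x + h\<close> for fixed \<open>x\<close>, and the
  evenness of \<open>N\<close> turn the measure of pairs into an integral over increments.\<close>

lemma emeasure_large_quotient:
  "emeasure (lborel :: ('a \<times> 'a) measure) {(x, y). x \<noteq> y \<and> l \<le> \<bar>f x - f y\<bar> / N (x - y) powr (real DIM('a) / p + 1)}
   = (\<integral>\<^sup>+h. (\<integral>\<^sup>+x. (if large_inc l x h then 1 else 0) \<partial>lborel) \<partial>lborel)"
  (is "emeasure _ ?E = _")
proof -
  have E [measurable]: "?E \<in> sets (lborel \<Otimes>\<^sub>M lborel)"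
  proof -
    have "Measurable.pred (borel \<Otimes>\<^sub>M borel) (\<lambda>z :: 'a \<times> 'a. fst z \<noteq> snd z \<and>
        l \<le> \<bar>f (fst z) - f (snd z)\<bar> / N (fst z - snd z) powr (real DIM('a) / p + 1))"
      by measurable
    then show ?thesis
      by (simp add: pred_def case_prod_beta' space_pair_measure cong: sets_pair_measure_cong)
  qed
  have eq: "(x, x + h) \<in> ?E \<longleftrightarrow> large_inc l x h" for x h
    using mink_pos[of h] mink_uminus[of h]
    by (auto simp: large_inc_def field_simps abs_minus_commute)
  have "emeasure (lborel :: ('a \<times> 'a) measure) ?E = (\<integral>\<^sup>+x. (\<integral>\<^sup>+y. indicator ?E (x, y) \<partial>lborel) \<partial>lborel)"
    unfolding lborel_prod[symmetric]
    using E by (subst lborel.nn_integral_fst) auto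
  also have "\<dots> = (\<integral>\<^sup>+x. (\<integral>\<^sup>+h. indicator ?E (x, x + h) \<partial>lborel) \<partial>lborel)"
  proof (rule nn_integral_cong)
    fix x
    have "(\<lambda>y. indicator ?E (x, y) :: ennreal) \<in> borel_measurable lborel" using E by measurable
    then show "(\<integral>\<^sup>+y. indicator ?E (x, y) \<partial>lborel) = (\<integral>\<^sup>+h. indicator ?E (x, x + h) \<partial>lborel)"
      by (subst nn_integral_lborel_translate[where F="\<lambda>y. indicator ?E (x, y)"]) auto
  qed
  also have "\<dots> = (\<integral>\<^sup>+x. (\<integral>\<^sup>+h. (if large_inc l x h then 1 else 0) \<partial>lborel) \<partial>lborel)"
    by (intro nn_integral_cong) (auto simp: eq[symmetric])
  also have "\<dots> = (\<integral>\<^sup>+h. (\<integral>\<^sup>+x. (if large_inc l x h then 1 else 0) \<partial>lborel) \<partial>lborel)"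
    by (rule lborel_pair.Fubini') measurable
  finally show ?thesis .
qed

end

section \<open>The upper bound\<close>

context body_fun
begin

text \<open>Along the ray of \<open>\<theta>\<close> homogeneity reduces the condition to that of
  \<open>line_estimate\<close> with \<open>\<kappa> = l * N \<theta> powr (n / p + 1)\<close>. The
  resulting power \<open>N \<theta> powr (n + p)\<close> in the denominator is the one that the
  polar weight with \<open>q = n + p\<close> cancels.\<close>

lemma radial_bound:
  assumes \<theta>: "\<theta> \<noteq> 0" and l: "l > 0"
  shows "(\<integral>\<^sup>+r. indicator {0<..} r * ennreal (r ^ (DIM('a) - 1)) *
        (\<integral>\<^sup>+x. (if large_inc l x (r *\<^sub>R \<theta>) then 1 else 0) \<partial>lborel) \<partial>lborel)
    \<le> ennreal (2 * 5 ^ (DIM('a) + 1) / (l powr p * N \<theta> powr (real DIM('a) + p))) *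
        (\<integral>\<^sup>+x. ennreal (\<bar>grad f x \<bullet> \<theta>\<bar> powr p) \<partial>lborel)"
proof -
  let ?a = "real DIM('a) / p + 1" and ?d = "DIM('a)"
  define J where "J = (\<integral>\<^sup>+x. ennreal (\<bar>grad f x \<bullet> \<theta>\<bar> powr p) \<partial>lborel)"
  define \<kappa> where "\<kappa> = l * N \<theta> powr ?a"
  have \<kappa>: "\<kappa> > 0" using l mink_pos[OF \<theta>] by (simp add: \<kappa>_def)
  have \<kappa>p: "\<kappa> powr p = l powr p * N \<theta> powr (real DIM('a) + p)"
    using l mink_nonneg[of \<theta>] by (simp add: \<kappa>_def powr_mult powr_powr exponent_times_p)
  define c where "c = 5 ^ (?d + 1) / \<kappa> powr p"
  have c: "c \<ge> 0" by (simp add: c_def)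
  have inc: "large_inc l x (r *\<^sub>R \<theta>) \<longleftrightarrow> \<kappa> * r powr ?a \<le> \<bar>f (x + r *\<^sub>R \<theta>) - f x\<bar>" if "r > 0" for x r
    using that \<theta> mink_nonneg[of \<theta>] by (simp add: large_inc_def mink_scale powr_mult \<kappa>_def mult_ac)
  obtain M where M: "M > 0" "\<And>x. \<bar>f x\<bar> \<le> M" using Cc_infty_bounded[OF f] by blast
  \<comment> \<open>Chosen so that \<open>\<kappa> * T powr ?a = 2 * M + 1\<close>, which no
    increment of \<open>f\<close> can reach; hence only radii \<open>r \<le> T\<close>
    contribute.\<close>
  define T where "T = ((2 * M + 1) / \<kappa>) powr (1 / ?a)"
  have T: "T > 0" using M \<kappa> by (simp add: T_def add_pos_pos)
  have far: "\<not> \<kappa> * r powr ?a \<le> \<bar>f (x + r *\<^sub>R \<theta>) - f x\<bar>" if "r > T" for r x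
  proof -
    have "2 * M + 1 = \<kappa> * T powr ?a"
      using M \<kappa> exponent_pos by (simp add: T_def powr_powr)
    also have "\<dots> \<le> \<kappa> * r powr ?a"
      using that T \<kappa> exponent_pos by (intro mult_left_mono powr_mono2) auto
    finally show ?thesis using M(2)[of "x + r *\<^sub>R \<theta>"] M(2)[of x] by simp
  qed
  define H where "H x = (\<integral>\<^sup>+r. indicator {0<..T} r * ennreal (r ^ (?d - 1)) *
      indicator {r. \<kappa> * r powr ?a \<le> \<bar>f (x + r *\<^sub>R \<theta>) - f x\<bar>} r \<partial>lborel)" for x
  have H': "H x = (\<integral>\<^sup>+r. indicator {0<..} r * ennreal (r ^ (?d - 1)) *
      (if large_inc l x (r *\<^sub>R \<theta>) then 1 else 0) \<partial>lborel)" for x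
    unfolding H_def
    by (intro nn_integral_cong) (use far in \<open>auto simp: inc not_le split: split_indicator\<close>)
  have [measurable]: "H \<in> borel_measurable borel" unfolding H'[abs_def] by measurable
  have "(\<integral>\<^sup>+r. indicator {0<..} r * ennreal (r ^ (?d - 1)) *
        (\<integral>\<^sup>+x. (if large_inc l x (r *\<^sub>R \<theta>) then 1 else 0) \<partial>lborel) \<partial>lborel)
     = (\<integral>\<^sup>+r. (\<integral>\<^sup>+x. indicator {0<..} r * ennreal (r ^ (?d - 1)) *
        (if large_inc l x (r *\<^sub>R \<theta>) then 1 else 0) \<partial>lborel) \<partial>lborel)"
    by (intro nn_integral_cong nn_integral_cmult[symmetric]) measurable
  also have "\<dots> = (\<integral>\<^sup>+x. H x \<partial>lborel)"
    unfolding H' by (rule lborel_pair.Fubini') measurable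
  finally have lhs: "(\<integral>\<^sup>+r. indicator {0<..} r * ennreal (r ^ (?d - 1)) *
        (\<integral>\<^sup>+x. (if large_inc l x (r *\<^sub>R \<theta>) then 1 else 0) \<partial>lborel) \<partial>lborel) = (\<integral>\<^sup>+x. H x \<partial>lborel)" .
  \<comment> \<open>The integral of \<open>H\<close> is averaged over the translations by \<open>s \<theta>\<close>, \<open>0 \<le> s \<le> T\<close>; since only
    increments of length at most \<open>T\<close> matter, the line estimate then sees a segment of length \<open>2 T\<close>,
    which costs a factor \<open>2\<close>.\<close>
  have ind: "(\<integral>\<^sup>+s. indicator {0..b} s \<partial>lborel) = ennreal b" if "b \<ge> 0" for b :: real
    using that by (subst nn_integral_indicator) auto
  have "ennreal T * (\<integral>\<^sup>+x. H x \<partial>lborel) = (\<integral>\<^sup>+s. indicator {0..T} s * (\<integral>\<^sup>+x. H x \<partial>lborel) \<partial>lborel)"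
    using T by (subst nn_integral_multc) (auto simp: ind)
  also have "\<dots> = (\<integral>\<^sup>+s. (\<integral>\<^sup>+x. indicator {0..T} s * H (s *\<^sub>R \<theta> + x) \<partial>lborel) \<partial>lborel)"
    by (intro nn_integral_cong) (simp add: nn_integral_cmult nn_integral_lborel_translate)
  also have "\<dots> = (\<integral>\<^sup>+x. (\<integral>\<^sup>+s. indicator {0..T} s * H (s *\<^sub>R \<theta> + x) \<partial>lborel) \<partial>lborel)"
    by (rule lborel_pair.Fubini') measurable
  also have "\<dots> \<le> (\<integral>\<^sup>+x. ennreal c * (\<integral>\<^sup>+t. indicator {0..2*T} t *
      ennreal (\<bar>grad f (x + t *\<^sub>R \<theta>) \<bullet> \<theta>\<bar> powr p) \<partial>lborel) \<partial>lborel)"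
  proof (rule nn_integral_mono)
    fix x :: 'a
    have "continuous_on UNIV (\<lambda>t. grad f (x + t *\<^sub>R \<theta>) \<bullet> \<theta>)"
      by (intro continuous_intros continuous_on_compose2[OF Cc_infty_continuous_on_grad[OF f, of UNIV]]) auto
    \<comment> \<open>With \<open>g t = f (x + t \<theta>)\<close>, the function \<open>H\<close> at
      \<open>x + s \<theta>\<close> sees exactly the increments
      \<open>g (s + r) - g s\<close>.\<close>
    from line_estimate[OF Cc_infty_line_derivative[OF f] this p T \<kappa> DIM_positive]
    show "(\<integral>\<^sup>+s. indicator {0..T} s * H (s *\<^sub>R \<theta> + x) \<partial>lborel) \<le> ennreal c * (\<integral>\<^sup>+t. indicator {0..2*T} t *
      ennreal (\<bar>grad f (x + t *\<^sub>R \<theta>) \<bullet> \<theta>\<bar> powr p) \<partial>lborel)"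
      unfolding H_def c_def by (simp add: scaleR_add_left add_ac)
  qed
  also have "\<dots> = ennreal c * (\<integral>\<^sup>+x. (\<integral>\<^sup>+t. indicator {0..2*T} t *
      ennreal (\<bar>grad f (x + t *\<^sub>R \<theta>) \<bullet> \<theta>\<bar> powr p) \<partial>lborel) \<partial>lborel)"
    by (rule nn_integral_cmult) measurable
  also have "(\<integral>\<^sup>+x. (\<integral>\<^sup>+t. indicator {0..2*T} t *
      ennreal (\<bar>grad f (x + t *\<^sub>R \<theta>) \<bullet> \<theta>\<bar> powr p) \<partial>lborel) \<partial>lborel)
    = (\<integral>\<^sup>+t. (\<integral>\<^sup>+x. indicator {0..2*T} t *
      ennreal (\<bar>grad f (x + t *\<^sub>R \<theta>) \<bullet> \<theta>\<bar> powr p) \<partial>lborel) \<partial>lborel)"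
    by (rule lborel_pair.Fubini') measurable
  also have "\<dots> = (\<integral>\<^sup>+t. indicator {0..2*T} t * J \<partial>lborel)"
  proof (rule nn_integral_cong)
    fix t :: real
    have "(\<integral>\<^sup>+x. ennreal (\<bar>grad f (t *\<^sub>R \<theta> + x) \<bullet> \<theta>\<bar> powr p) \<partial>lborel) = J"
      unfolding J_def by (subst nn_integral_lborel_translate[where F="\<lambda>x. ennreal (\<bar>grad f x \<bullet> \<theta>\<bar> powr p)"]) auto
    then show "(\<integral>\<^sup>+x. indicator {0..2*T} t *
      ennreal (\<bar>grad f (x + t *\<^sub>R \<theta>) \<bullet> \<theta>\<bar> powr p) \<partial>lborel) = indicator {0..2*T} t * J"
      by (subst nn_integral_cmult) (auto simp: add.commute)
  qed
  also have "\<dots> = ennreal (2 * T) * J"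
    using T by (subst nn_integral_multc) (auto simp: ind)
  finally have "ennreal T * (\<integral>\<^sup>+x. H x \<partial>lborel) \<le> ennreal c * (ennreal (2 * T) * J)"
    by (simp add: mult_left_mono)
  then have "ennreal (1 / T) * (ennreal T * (\<integral>\<^sup>+x. H x \<partial>lborel)) \<le> ennreal (1 / T) * (ennreal c * (ennreal (2 * T) * J))"
    by (rule mult_left_mono) simp
  moreover have "ennreal (1 / T) * (ennreal T * (\<integral>\<^sup>+x. H x \<partial>lborel)) = (\<integral>\<^sup>+x. H x \<partial>lborel)"
    using T by (simp add: mult.assoc[symmetric] flip: ennreal_mult)
  moreover have "ennreal (1 / T) * (ennreal c * (ennreal (2 * T) * J)) = ennreal (2 * c) * J"
  proof -
    have "ennreal (1 / T) * (ennreal c * ennreal (2 * T)) = ennreal (1 / T * (c * (2 * T)))"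
      using T c by (subst ennreal_mult; simp add: ennreal_mult)
    also have "1 / T * (c * (2 * T)) = 2 * c" using T by simp
    finally show ?thesis by (metis mult.assoc)
  qed
  ultimately show ?thesis
    unfolding lhs J_def[symmetric] by (simp add: c_def \<kappa>p)
qed

lemma nn_integral_W_grad:
  "(\<integral>\<^sup>+x. W (grad f x) \<partial>lborel) = (\<integral>\<^sup>+\<theta>. indicator K \<theta> * (\<integral>\<^sup>+x. ennreal (\<bar>grad f x \<bullet> \<theta>\<bar> powr p) \<partial>lborel) \<partial>lborel)"
proof -
  have "(\<integral>\<^sup>+x. W (grad f x) \<partial>lborel) = (\<integral>\<^sup>+\<theta>. (\<integral>\<^sup>+x. indicator K \<theta> * ennreal (\<bar>grad f x \<bullet> \<theta>\<bar> powr p) \<partial>lborel) \<partial>lborel)"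
    unfolding W_def by (rule lborel_pair.Fubini') measurable
  also have "\<dots> = (\<integral>\<^sup>+\<theta>. indicator K \<theta> * (\<integral>\<^sup>+x. ennreal (\<bar>grad f x \<bullet> \<theta>\<bar> powr p) \<partial>lborel) \<partial>lborel)"
    by (intro nn_integral_cong nn_integral_cmult) measurable
  finally show ?thesis .
qed

lemma nn_integral_Zp:
  "(\<integral>\<^sup>+x. ennreal (Zp_polar_norm p K (grad f x) powr p) \<partial>lborel)
    = ennreal ((real DIM('a) + p) / 2) * (\<integral>\<^sup>+x. W (grad f x) \<partial>lborel)"
  by (simp only: Zp_polar_norm_powr, rule nn_integral_cmult) simp

text \<open>The polar formula with \<open>q = n + p\<close> leaves \<open>A * q / l powr p\<close>
  times the integral of \<open>W (grad f x)\<close>. The normalisation \<open>q / 2\<close> of the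
  polar moment norm absorbs \<open>q\<close>, so the constant becomes \<open>2 * A\<close>,
  independent of \<open>p\<close>, \<open>K\<close> and \<open>f\<close>.\<close>

lemma weak_bound:
  assumes l: "l > 0"
  shows "ennreal (l powr p) * (\<integral>\<^sup>+h. (\<integral>\<^sup>+x. (if large_inc l x h then 1 else 0) \<partial>lborel) \<partial>lborel)
    \<le> ennreal (4 * 5 ^ (DIM('a) + 1)) * (\<integral>\<^sup>+x. ennreal (Zp_polar_norm p K (grad f x) powr p) \<partial>lborel)"
proof -
  let ?q = "real DIM('a) + p"
  define J where "J \<theta> = (\<integral>\<^sup>+x. ennreal (\<bar>grad f x \<bullet> \<theta>\<bar> powr p) \<partial>lborel)" for \<theta>
  have [measurable]: "J \<in> borel_measurable borel" unfolding J_def by measurable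
  define A :: real where "A = 2 * 5 ^ (DIM('a) + 1)"
  have A: "A \<ge> 0" by (simp add: A_def)
  have q: "?q > 0" using p by (simp add: add_nonneg_pos)
  have "(\<integral>\<^sup>+h. (\<integral>\<^sup>+x. (if large_inc l x h then 1 else 0) \<partial>lborel) \<partial>lborel)
    = (\<integral>\<^sup>+\<theta>. indicator K \<theta> * ennreal (?q * N \<theta> powr ?q) *
      (\<integral>\<^sup>+r. indicator {0<..} r * ennreal (r ^ (DIM('a) - 1)) *
        (\<integral>\<^sup>+x. (if large_inc l x (r *\<^sub>R \<theta>) then 1 else 0) \<partial>lborel) \<partial>lborel) \<partial>lborel)"
    by (rule nn_integral_polar[OF _ q]) measurable
  also have "\<dots> \<le> (\<integral>\<^sup>+\<theta>. ennreal (A * ?q / l powr p) * (indicator K \<theta> * J \<theta>) \<partial>lborel)"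
  proof (rule nn_integral_mono)
    fix \<theta> :: 'a
    show "indicator K \<theta> * ennreal (?q * N \<theta> powr ?q) *
      (\<integral>\<^sup>+r. indicator {0<..} r * ennreal (r ^ (DIM('a) - 1)) *
        (\<integral>\<^sup>+x. (if large_inc l x (r *\<^sub>R \<theta>) then 1 else 0) \<partial>lborel) \<partial>lborel)
      \<le> ennreal (A * ?q / l powr p) * (indicator K \<theta> * J \<theta>)" (is "_ * ?R \<le> _")
    proof (cases "\<theta> = 0")
      case False
      have "indicator K \<theta> * ennreal (?q * N \<theta> powr ?q) * ?R
        \<le> indicator K \<theta> * ennreal (?q * N \<theta> powr ?q) * (ennreal (A / (l powr p * N \<theta> powr ?q)) * J \<theta>)"
        unfolding A_def J_def by (intro mult_left_mono radial_bound False l) simp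
      also have "\<dots> = indicator K \<theta> * ((ennreal (?q * N \<theta> powr ?q) * ennreal (A / (l powr p * N \<theta> powr ?q))) * J \<theta>)"
        by (simp add: mult_ac)
      also have "ennreal (?q * N \<theta> powr ?q) * ennreal (A / (l powr p * N \<theta> powr ?q)) = ennreal (A * ?q / l powr p)"
        using mink_pos[OF False] q l A by (simp flip: ennreal_mult)
      finally show ?thesis by (simp add: mult_ac)
    \<comment> \<open>At \<open>\<theta> = 0\<close> the weight \<open>N \<theta> powr ?q\<close>
      vanishes.\<close>
    qed (use q in simp)
  qed
  also have "\<dots> = ennreal (A * ?q / l powr p) * (\<integral>\<^sup>+x. W (grad f x) \<partial>lborel)"
    unfolding nn_integral_W_grad J_def[symmetric] by (rule nn_integral_cmult) measurable
  finally have "ennreal (l powr p) * (\<integral>\<^sup>+h. (\<integral>\<^sup>+x. (if large_inc l x h then 1 else 0) \<partial>lborel) \<partial>lborel)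
     \<le> ennreal (l powr p) * (ennreal (A * ?q / l powr p) * (\<integral>\<^sup>+x. W (grad f x) \<partial>lborel))"
    by (rule mult_left_mono) simp
  also have "\<dots> = ennreal (A * ?q) * (\<integral>\<^sup>+x. W (grad f x) \<partial>lborel)"
    using l A q by (simp add: mult.assoc[symmetric] flip: ennreal_mult)
  also have "\<dots> = ennreal (2 * A) * (ennreal (?q / 2) * (\<integral>\<^sup>+x. W (grad f x) \<partial>lborel))"
    using A q by (simp add: mult.assoc[symmetric] flip: ennreal_mult)
  finally show ?thesis unfolding nn_integral_Zp A_def by simp
qed

end

section \<open>The limit\<close>

context body_fun
begin

text \<open>On each ray the admissible radii form an interval ending at \<open>m\<close>, with
  \<open>m ^ n = \<bar>z \<bullet> \<theta>\<bar> powr p / N \<theta> powr (n + p)\<close>. The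
  polar weight with \<open>q = n + p\<close> cancels the denominator and leaves the moment
  integral.\<close>

lemma nn_integral_cone_volume:
  "(\<integral>\<^sup>+u. (if u \<noteq> 0 \<and> N u powr (real DIM('a) / p + 1) \<le> \<bar>z \<bullet> u\<bar> then 1 else 0) \<partial>lborel)
    = ennreal ((real DIM('a) + p) / real DIM('a)) * W z"
proof -
  let ?a = "real DIM('a) / p + 1" and ?q = "real DIM('a) + p" and ?n = "DIM('a)"
  have q: "?q > 0" using p by (simp add: add_nonneg_pos)
  have n: "?n > 0" by simp
  have "(\<integral>\<^sup>+u. (if u \<noteq> 0 \<and> N u powr ?a \<le> \<bar>z \<bullet> u\<bar> then 1 else 0) \<partial>lborel)
    = (\<integral>\<^sup>+\<theta>. indicator K \<theta> * ennreal (?q * N \<theta> powr ?q) *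
      (\<integral>\<^sup>+r. indicator {0<..} r * ennreal (r ^ (?n - 1)) *
        (if r *\<^sub>R \<theta> \<noteq> 0 \<and> N (r *\<^sub>R \<theta>) powr ?a \<le> \<bar>z \<bullet> (r *\<^sub>R \<theta>)\<bar> then 1 else 0) \<partial>lborel) \<partial>lborel)"
    by (rule nn_integral_polar[OF _ q]) measurable
  also have "\<dots> = (\<integral>\<^sup>+\<theta>. ennreal (?q / ?n) * (indicator K \<theta> * ennreal (\<bar>z \<bullet> \<theta>\<bar> powr p)) \<partial>lborel)"
  proof (rule nn_integral_cong)
    fix \<theta> :: 'a
    show "indicator K \<theta> * ennreal (?q * N \<theta> powr ?q) *
      (\<integral>\<^sup>+r. indicator {0<..} r * ennreal (r ^ (?n - 1)) *
        (if r *\<^sub>R \<theta> \<noteq> 0 \<and> N (r *\<^sub>R \<theta>) powr ?a \<le> \<bar>z \<bullet> (r *\<^sub>R \<theta>)\<bar> then 1 else 0) \<partial>lborel)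
      = ennreal (?q / ?n) * (indicator K \<theta> * ennreal (\<bar>z \<bullet> \<theta>\<bar> powr p))" (is "_ * ?R = _")
    proof (cases "\<theta> = 0")
      case False
      note pos = mink_pos[OF False]
      define b where "b = \<bar>z \<bullet> \<theta>\<bar> / N \<theta> powr ?a"
      define m where "m = b powr (p / ?n)"
      have b: "b \<ge> 0" by (simp add: b_def)
      have m: "m \<ge> 0" by (simp add: m_def)
      \<comment> \<open>One factor \<open>r\<close> cancels because the right side is homogeneous of
        degree one, leaving \<open>r powr (n / p) \<le> b\<close>.\<close>
      have iff: "r *\<^sub>R \<theta> \<noteq> 0 \<and> N (r *\<^sub>R \<theta>) powr ?a \<le> \<bar>z \<bullet> (r *\<^sub>R \<theta>)\<bar> \<longleftrightarrow> r \<le> m" if r: "r > 0" for r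
      proof -
        have "N (r *\<^sub>R \<theta>) powr ?a = r * (r powr (?n / p) * N \<theta> powr ?a)"
          using r pos by (simp add: mink_scale powr_mult powr_add)
        then have "N (r *\<^sub>R \<theta>) powr ?a \<le> \<bar>z \<bullet> (r *\<^sub>R \<theta>)\<bar> \<longleftrightarrow> r powr (?n / p) \<le> b"
          using r pos by (simp add: b_def abs_mult field_simps)
        also have "\<dots> \<longleftrightarrow> r \<le> m"
        proof
          assume "r powr (?n / p) \<le> b"
          then have "(r powr (?n / p)) powr (p / ?n) \<le> m"
            unfolding m_def using p by (intro powr_mono2) auto
          then show "r \<le> m" using r p by (simp add: powr_powr)
        next
          assume "r \<le> m"
          then have "r powr (?n / p) \<le> m powr (?n / p)"
            using r p by (intro powr_mono2) auto
          then show "r powr (?n / p) \<le> b" using b p by (simp add: m_def powr_powr)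
        qed
        finally show ?thesis using r False by simp
      qed
      have "?R = (\<integral>\<^sup>+r. ennreal (r ^ (?n - 1)) * indicator {0..m} r \<partial>lborel)"
      proof (rule nn_integral_cong_AE)
        show "AE r in lborel. indicator {0<..} r * ennreal (r ^ (?n - 1)) *
          (if r *\<^sub>R \<theta> \<noteq> 0 \<and> N (r *\<^sub>R \<theta>) powr ?a \<le> \<bar>z \<bullet> (r *\<^sub>R \<theta>)\<bar> then 1 else 0)
          = ennreal (r ^ (?n - 1)) * indicator {0..m} r"
          \<comment> \<open>The two integrands can differ only at \<open>r = 0\<close>.\<close>
          using AE_lborel_singleton[of "0::real"]
        proof eventually_elim
          case (elim r)
          then show ?case using iff[of r] by (cases "r > 0") (auto split: split_indicator)
        qed
      qed
      also have "\<dots> = ennreal (m ^ ?n / ?n)" by (rule nn_integral_monomial[OF m n])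
      also have "m ^ ?n = b powr p"
        using m b p by (cases "b = 0") (auto simp: m_def powr_powr powr_realpow[symmetric])
      also have "b powr p = \<bar>z \<bullet> \<theta>\<bar> powr p / N \<theta> powr ?q"
        using pos by (simp only: b_def powr_divide abs_ge_zero powr_ge_zero powr_powr exponent_times_p)
      finally have R: "?R = ennreal (\<bar>z \<bullet> \<theta>\<bar> powr p / N \<theta> powr ?q / ?n)" .
      have "ennreal (?q * N \<theta> powr ?q) * ?R = ennreal (?q / ?n) * ennreal (\<bar>z \<bullet> \<theta>\<bar> powr p)"
        unfolding R using pos q by (simp flip: ennreal_mult)
      then show ?thesis by (simp add: mult_ac split: split_indicator)
    qed (use p q in simp)
  qed
  also have "\<dots> = ennreal (?q / ?n) * W z"
    unfolding W_def by (rule nn_integral_cmult) measurable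
  finally show ?thesis .
qed

text \<open>Each ray meets the equality set in at most one radius, so polar coordinates make it a
  null set. It is the set where convergence of the indicators could fail.\<close>

lemma AE_not_cone_boundary:
  "AE u in lborel. \<not> (u \<noteq> 0 \<and> N u powr (real DIM('a) / p + 1) = \<bar>z \<bullet> u\<bar>)"
proof -
  let ?a = "real DIM('a) / p + 1" and ?n = "DIM('a)"
  let ?P = "\<lambda>u. u \<noteq> 0 \<and> N u powr ?a = \<bar>z \<bullet> u\<bar>"
  define \<phi> :: "'a \<Rightarrow> ennreal" where "\<phi> u = (if ?P u then 1 else 0)" for u
  have [measurable]: "Measurable.pred borel ?P" by measurable
  then have \<phi> [measurable]: "\<phi> \<in> borel_measurable borel" unfolding \<phi>_def[abs_def] by measurable
  have zero: "(\<integral>\<^sup>+r. indicator {0<..} r * ennreal (r ^ (?n - 1)) * \<phi> (r *\<^sub>R \<theta>) \<partial>lborel) = 0"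
    if "\<theta> \<noteq> 0" for \<theta>
  proof -
    define m where "m = (\<bar>z \<bullet> \<theta>\<bar> / N \<theta> powr ?a) powr (p / ?n)"
    have *: "r = m" if r: "r > 0" and P: "?P (r *\<^sub>R \<theta>)" for r
    proof -
      have pos: "N \<theta> > 0" using mink_pos[OF \<open>\<theta> \<noteq> 0\<close>] .
      have "N (r *\<^sub>R \<theta>) powr ?a = r * (r powr (?n / p) * N \<theta> powr ?a)"
        using r pos by (simp add: mink_scale powr_mult powr_add)
      then have "r powr (?n / p) = \<bar>z \<bullet> \<theta>\<bar> / N \<theta> powr ?a"
        using r pos P by (simp add: abs_mult field_simps)
      then have "m = (r powr (?n / p)) powr (p / ?n)" by (simp add: m_def)
      then show ?thesis using r p by (simp add: powr_powr)
    qed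
    have "(\<integral>\<^sup>+r. indicator {0<..} r * ennreal (r ^ (?n - 1)) * \<phi> (r *\<^sub>R \<theta>) \<partial>lborel)
      = (\<integral>\<^sup>+(r::real). 0 \<partial>lborel)"
    proof (rule nn_integral_cong_AE)
      show "AE r in lborel. indicator {0<..} r * ennreal (r ^ (?n - 1)) * \<phi> (r *\<^sub>R \<theta>) = 0"
        using AE_lborel_singleton[of m] by eventually_elim (use * in \<open>auto simp: \<phi>_def split: split_indicator\<close>)
    qed
    then show ?thesis by simp
  qed
  \<comment> \<open>The inner radial integral is zero, so any positive exponent would serve;
    \<open>q = 1\<close> is taken.\<close>
  have "(\<integral>\<^sup>+u. \<phi> u \<partial>lborel) = (\<integral>\<^sup>+\<theta>. indicator K \<theta> * ennreal (1 * N \<theta> powr 1) *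
      (\<integral>\<^sup>+r. indicator {0<..} r * ennreal (r ^ (?n - 1)) * \<phi> (r *\<^sub>R \<theta>) \<partial>lborel) \<partial>lborel)"
    by (rule nn_integral_polar[OF \<phi>]) simp
  also have "\<dots> = (\<integral>\<^sup>+(\<theta>::'a). 0 \<partial>lborel)"
  proof (rule nn_integral_cong)
    fix \<theta> :: 'a
    show "indicator K \<theta> * ennreal (1 * N \<theta> powr 1) *
      (\<integral>\<^sup>+r. indicator {0<..} r * ennreal (r ^ (?n - 1)) * \<phi> (r *\<^sub>R \<theta>) \<partial>lborel) = 0"
    proof (cases "\<theta> = 0")
      case False
      show ?thesis unfolding zero[OF False] by simp
    qed simp
  qed
  finally have "(\<integral>\<^sup>+u. \<phi> u \<partial>lborel) = 0" by simp
  then have "AE u in lborel. \<phi> u = 0"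
    by (subst (asm) nn_integral_0_iff_AE) simp_all
  then show ?thesis by eventually_elim (auto simp: \<phi>_def split: if_splits)
qed

text \<open>The increment condition after the substitution \<open>h = \<epsilon> u\<close>, for
  \<open>w = (x, u)\<close>, written as a difference quotient that tends to the directional
  derivative as \<epsilon> tends to \<open>0\<close>.\<close>

definition steep :: "real \<Rightarrow> 'a \<times> 'a \<Rightarrow> bool" where
  "steep \<epsilon> w \<longleftrightarrow> snd w \<noteq> 0 \<and>
     N (snd w) powr (real DIM('a) / p + 1) \<le> \<bar>f (fst w + \<epsilon> *\<^sub>R snd w) - f (fst w)\<bar> / \<epsilon>"

lemma steep_measurable [measurable]: "Measurable.pred (borel \<Otimes>\<^sub>M borel) (steep \<epsilon>)"
  unfolding steep_def by measurable

text \<open>The single choice \<open>\<epsilon> = l powr (- p / n)\<close> does two things: the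
  Jacobian \<open>\<epsilon> ^ n\<close> cancels \<open>l powr p\<close>, and
  \<open>l * \<epsilon> powr (n / p + 1) = \<epsilon>\<close> turns the condition into
  \<open>steep\<close>.\<close>

lemma rescale:
  assumes l: "l > 0"
  shows "ennreal (l powr p) * (\<integral>\<^sup>+h. (\<integral>\<^sup>+x. (if large_inc l x h then 1 else 0) \<partial>lborel) \<partial>lborel)
    = (\<integral>\<^sup>+w. (if steep (l powr (- p / real DIM('a))) w then 1 else 0) \<partial>(lborel \<Otimes>\<^sub>M lborel))"
proof -
  let ?a = "real DIM('a) / p + 1" and ?n = "DIM('a)"
  define \<epsilon> where "\<epsilon> = l powr (- p / ?n)"
  have \<epsilon>: "\<epsilon> > 0" using l by (simp add: \<epsilon>_def)
  have 1: "l powr p * \<epsilon> ^ ?n = 1"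
    using \<epsilon> l by (simp add: \<epsilon>_def powr_powr flip: powr_realpow powr_add)
  have "l * \<epsilon> powr (?n / p) = 1"
  proof -
    have "\<epsilon> powr (?n / p) = l powr (- 1)" using p by (simp add: \<epsilon>_def powr_powr)
    then show ?thesis using l by (simp add: powr_minus)
  qed
  then have 2: "l * \<epsilon> powr ?a = \<epsilon>" using \<epsilon> by (simp add: powr_add flip: mult.assoc)
  have inc: "large_inc l x (\<epsilon> *\<^sub>R u) \<longleftrightarrow> steep \<epsilon> (x, u)" for x u
  proof -
    have "l * N (\<epsilon> *\<^sub>R u) powr ?a = (l * \<epsilon> powr ?a) * N u powr ?a"
      using \<epsilon> mink_nonneg[of u] by (simp add: mink_scale powr_mult)
    then show ?thesis using \<epsilon> unfolding 2 by (simp add: large_inc_def steep_def field_simps)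
  qed
  have "(\<integral>\<^sup>+h. (\<integral>\<^sup>+x. (if large_inc l x h then 1 else 0) \<partial>lborel) \<partial>lborel)
    = ennreal (\<epsilon> ^ ?n) * (\<integral>\<^sup>+u. (\<integral>\<^sup>+x. (if large_inc l x (\<epsilon> *\<^sub>R u) then 1 else 0) \<partial>lborel) \<partial>lborel)"
    using \<epsilon> by (subst nn_integral_lborel_affine[of _ \<epsilon> 0]) auto
  also have "(\<integral>\<^sup>+u. (\<integral>\<^sup>+x. (if large_inc l x (\<epsilon> *\<^sub>R u) then 1 else 0) \<partial>lborel) \<partial>lborel)
    = (\<integral>\<^sup>+w. (if steep \<epsilon> w then 1 else 0) \<partial>(lborel \<Otimes>\<^sub>M lborel))"
    unfolding inc by (rule lborel_pair.nn_integral_snd) measurable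
  finally show ?thesis
    unfolding \<epsilon>_def[symmetric] using l \<epsilon> by (simp add: 1 mult.assoc[symmetric] flip: ennreal_mult)
qed

text \<open>Dominated convergence: for scales at most \<open>1\<close> all steep pairs lie in one
  bounded set \<open>Q\<close>, and off the boundary set the indicators converge pointwise.\<close>

lemma steep_limit:
  assumes e0: "e \<longlonglongrightarrow> 0" and e: "\<And>k. 0 < e k" "\<And>k. e k \<le> 1"
  shows "(\<lambda>k. \<integral>\<^sup>+w. (if steep (e k) w then 1 else 0 :: ennreal) \<partial>(lborel \<Otimes>\<^sub>M lborel)) \<longlonglongrightarrow>
    (\<integral>\<^sup>+w. (if snd w \<noteq> 0 \<and> N (snd w) powr (real DIM('a) / p + 1) \<le> \<bar>grad f (fst w) \<bullet> snd w\<bar> then 1 else 0) \<partial>(lborel \<Otimes>\<^sub>M lborel))"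
proof -
  let ?a = "real DIM('a) / p + 1" and ?n = "DIM('a)"
  obtain L where L: "L > 0" "\<And>x. norm (grad f x) \<le> L" using Cc_infty_bounded_grad[OF f] by blast
  obtain R where R: "R > 0" "\<And>x. norm x > R \<Longrightarrow> f x = 0" using Cc_infty_support[OF f] by blast
  obtain B where B: "B > 0" "\<And>x. norm x \<le> B * N x" using ex_norm_le_mink by blast
  \<comment> \<open>The Lipschitz bound gives \<open>N u powr ?a \<le> L * B * N u\<close>, hence
    \<open>N u powr (n / p) \<le> L * B\<close>; \<open>R2\<close> is the resulting bound on
    \<open>norm u\<close>.\<close>
  define R2 where "R2 = B * (L * B) powr (p / ?n)"
  define Q where "Q = cball (0::'a) (R + R2) \<times> cball (0::'a) R2"
  have bound: "w \<in> Q" if "steep (e k) w" for k w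
  proof -
    obtain x u where w: "w = (x, u)" by fastforce
    have u: "u \<noteq> 0" and le: "N u powr ?a \<le> \<bar>f (x + e k *\<^sub>R u) - f x\<bar> / e k"
      using that by (auto simp: steep_def w)
    note pos = mink_pos[OF u]
    have "\<bar>f (x + e k *\<^sub>R u) - f x\<bar> \<le> L * (e k * norm u)"
      using Cc_infty_lipschitz[OF f L(2), of x "e k *\<^sub>R u"] e(1)[of k] by simp
    then have "\<bar>f (x + e k *\<^sub>R u) - f x\<bar> / e k \<le> L * norm u"
      using e(1)[of k] by (simp add: field_simps)
    also have "\<dots> \<le> L * (B * N u)" using L B(2) by (intro mult_left_mono) auto
    finally have "N u powr ?a \<le> L * B * N u" using le by simp
    then have "N u powr (?n / p) \<le> L * B" using pos by (simp add: powr_add)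
    then have "(N u powr (?n / p)) powr (p / ?n) \<le> (L * B) powr (p / ?n)"
      using p by (intro powr_mono2) auto
    then have "N u \<le> (L * B) powr (p / ?n)" using p pos by (simp add: powr_powr)
    then have "B * N u \<le> R2" unfolding R2_def using B by simp
    then have u2: "norm u \<le> R2" using B(2)[of u] by linarith
    have "N u powr ?a > 0" using pos by simp
    \<comment> \<open>A nonzero increment puts one of the two points in the ball of radius
      \<open>R\<close>; since \<open>e k \<le> 1\<close>, they are at most \<open>R2\<close>
      apart.\<close>
    then have "f (x + e k *\<^sub>R u) \<noteq> f x" using le by auto
    then have "norm x \<le> R \<or> norm (x + e k *\<^sub>R u) \<le> R"
      using R(2) by (metis not_le)
    moreover have "norm x \<le> norm (x + e k *\<^sub>R u) + norm (e k *\<^sub>R u)"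
      using norm_triangle_ineq4[of "x + e k *\<^sub>R u" "e k *\<^sub>R u"] by simp
    moreover have "norm (e k *\<^sub>R u) \<le> norm u" 
      using e[of k] mult_right_mono[of "e k" 1 "norm u"] by simp
    ultimately have "norm x \<le> R + R2" using u2 norm_ge_zero[of u] by linarith
    then show ?thesis using u2 by (simp add: w Q_def)
  qed
  have conv: "(\<lambda>k. if steep (e k) (x, u) then 1 else 0 :: ennreal) \<longlonglongrightarrow>
    (if u \<noteq> 0 \<and> N u powr ?a \<le> \<bar>grad f x \<bullet> u\<bar> then 1 else 0)"
    if nb: "\<not> (u \<noteq> 0 \<and> N u powr ?a = \<bar>grad f x \<bullet> u\<bar>)" for x u
  proof (cases "u = 0")
    case False
    have "((\<lambda>t. (f (x + t *\<^sub>R u) - f x) / t) \<longlongrightarrow> grad f x \<bullet> u) (at 0)"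
      using Cc_infty_line_derivative[OF f, of x u 0] unfolding DERIV_def by simp
    then have this': "(\<lambda>k. (f (x + e k *\<^sub>R u) - f x) / e k) \<longlonglongrightarrow> grad f x \<bullet> u"
      by (rule filterlim_compose) (use e0 e in \<open>auto simp: filterlim_at less_imp_neq[THEN not_sym]\<close>)
    then have lim: "(\<lambda>k. \<bar>f (x + e k *\<^sub>R u) - f x\<bar> / e k) \<longlonglongrightarrow> \<bar>grad f x \<bullet> u\<bar>"
      using tendsto_rabs[OF this'] e(1) by (simp add: abs_of_pos)
    show ?thesis
    \<comment> \<open>With equality excluded, a strict inequality persists for large
      \<open>k\<close>, so the indicator is eventually constant.\<close>
    proof (cases "N u powr ?a < \<bar>grad f x \<bullet> u\<bar>")
      case True
      have "\<forall>\<^sub>F k in sequentially. (if steep (e k) (x, u) then 1 else 0 :: ennreal) = 1"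
        using order_tendstoD(1)[OF lim True] by eventually_elim (use False in \<open>auto simp: steep_def\<close>)
      then show ?thesis using True False by (simp add: tendsto_eventually)
    next
      case False': False
      then have gt: "\<bar>grad f x \<bullet> u\<bar> < N u powr ?a" using nb False by auto
      have "\<forall>\<^sub>F k in sequentially. (if steep (e k) (x, u) then 1 else 0 :: ennreal) = 0"
        using order_tendstoD(2)[OF lim gt] by eventually_elim (auto simp: steep_def)
      then show ?thesis using gt by (simp add: tendsto_eventually)
    qed
  qed (simp add: steep_def)
  have Q [measurable]: "Q \<in> sets (lborel \<Otimes>\<^sub>M lborel)"
    unfolding Q_def by (intro pair_measureI) auto
  show ?thesis
  proof (rule nn_integral_dominated_convergence[where w="indicator Q"])
    show "AE w in lborel \<Otimes>\<^sub>M lborel. (if steep (e k) w then 1 else 0) \<le> (indicator Q w :: ennreal)" for k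
      using bound by (intro AE_I2) auto
    have "bounded Q" unfolding Q_def by (intro bounded_Times bounded_cball)
    then have "emeasure (lborel \<Otimes>\<^sub>M lborel) Q < \<infinity>"
      unfolding lborel_prod by (rule emeasure_bounded_finite)
    then show "(\<integral>\<^sup>+w. indicator Q w \<partial>(lborel \<Otimes>\<^sub>M lborel)) < \<infinity>"
      by (subst nn_integral_indicator[OF Q])
    show "AE w in lborel \<Otimes>\<^sub>M lborel. (\<lambda>k. if steep (e k) w then 1 else 0 :: ennreal) \<longlonglongrightarrow>
      (if snd w \<noteq> 0 \<and> N (snd w) powr ?a \<le> \<bar>grad f (fst w) \<bullet> snd w\<bar> then 1 else 0)"
    proof -
      have "AE w in lborel \<Otimes>\<^sub>M lborel. \<not> (snd w \<noteq> 0 \<and> N (snd w) powr ?a = \<bar>grad f (fst w) \<bullet> snd w\<bar>)"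
        by (rule lborel_pair.AE_pair_measure) (measurable, simp add: AE_not_cone_boundary[simplified])
      then show ?thesis
        by eventually_elim (metis conv prod.collapse)
    qed
  qed measurable
qed

lemma weak_limit:
  "((\<lambda>l. ennreal (l powr p) * (\<integral>\<^sup>+h. (\<integral>\<^sup>+x. (if large_inc l x h then 1 else 0) \<partial>lborel) \<partial>lborel)) \<longlongrightarrow>
    ennreal (2 / real DIM('a)) * (\<integral>\<^sup>+x. ennreal (Zp_polar_norm p K (grad f x) powr p) \<partial>lborel)) at_top"
proof (rule tendsto_at_topI_sequentially)
  let ?a = "real DIM('a) / p + 1" and ?n = "DIM('a)"
  fix X :: "nat \<Rightarrow> real" assume X: "filterlim X at_top sequentially"
  \<comment> \<open>An initial segment is dropped so that all levels are at least \<open>1\<close>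
    and the scales \<open>e k\<close> at most \<open>1\<close>, as \<open>steep_limit\<close>
    requires.\<close>
  have "\<forall>\<^sub>F k in sequentially. X k \<ge> 1" using X by (simp add: filterlim_at_top)
  then obtain k0 where k0: "\<And>k. k \<ge> k0 \<Longrightarrow> X k \<ge> 1" by (auto simp: eventually_sequentially)
  define Y where "Y k = X (k + k0)" for k
  have Y: "filterlim Y at_top sequentially" "\<And>k. Y k \<ge> 1"
    unfolding Y_def using X k0 by (auto intro: filterlim_compose filterlim_add_const_nat_at_top)
  define e where "e k = Y k powr (- p / ?n)" for k
  have "e \<longlonglongrightarrow> 0" unfolding e_def
    by (intro tendsto_neg_powr Y) (use p in \<open>auto simp: divide_less_0_iff\<close>)
  moreover have "0 < e k" "e k \<le> 1" for k
    using Y(2)[of k] p powr_mono2'[of "- p / ?n" 1 "Y k"] by (auto simp: e_def)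
  ultimately have lim: "(\<lambda>k. \<integral>\<^sup>+w. (if steep (e k) w then 1 else 0 :: ennreal) \<partial>(lborel \<Otimes>\<^sub>M lborel)) \<longlonglongrightarrow>
    (\<integral>\<^sup>+w. (if snd w \<noteq> 0 \<and> N (snd w) powr ?a \<le> \<bar>grad f (fst w) \<bullet> snd w\<bar> then 1 else 0) \<partial>(lborel \<Otimes>\<^sub>M lborel))"
    by (rule steep_limit)
  define G :: "'a \<times> 'a \<Rightarrow> ennreal" where
    "G w = (if snd w \<noteq> 0 \<and> N (snd w) powr ?a \<le> \<bar>grad f (fst w) \<bullet> snd w\<bar> then 1 else 0)" for w
  have G: "G \<in> borel_measurable (lborel \<Otimes>\<^sub>M lborel)" unfolding G_def[abs_def] by measurable
  have "(\<integral>\<^sup>+w. G w \<partial>(lborel \<Otimes>\<^sub>M lborel)) = (\<integral>\<^sup>+x. (\<integral>\<^sup>+u. G (x, u) \<partial>lborel) \<partial>lborel)"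
    by (rule lborel.nn_integral_fst[OF G, symmetric])
  also have "\<dots> = (\<integral>\<^sup>+x. (\<integral>\<^sup>+u. (if u \<noteq> 0 \<and> N u powr ?a \<le> \<bar>grad f x \<bullet> u\<bar> then 1 else 0) \<partial>lborel) \<partial>lborel)"
    unfolding G_def fst_conv snd_conv ..
  also have "\<dots> = (\<integral>\<^sup>+x. ennreal ((?n + p) / ?n) * W (grad f x) \<partial>lborel)"
    by (simp only: nn_integral_cone_volume)
  also have "\<dots> = ennreal ((?n + p) / ?n) * (\<integral>\<^sup>+x. W (grad f x) \<partial>lborel)"
    by (rule nn_integral_cmult) simp
  also have "ennreal ((?n + p) / ?n) = ennreal (2 / ?n) * ennreal ((?n + p) / 2)"
    using p by (simp add: field_simps flip: ennreal_mult)
  finally have "(\<lambda>k. \<integral>\<^sup>+w. (if steep (e k) w then 1 else 0 :: ennreal) \<partial>(lborel \<Otimes>\<^sub>M lborel)) \<longlonglongrightarrow>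
    ennreal (2 / ?n) * (\<integral>\<^sup>+x. ennreal (Zp_polar_norm p K (grad f x) powr p) \<partial>lborel)"
    using lim unfolding nn_integral_Zp G_def by (simp only: mult.assoc)
  moreover have "Y k > 0" for k using Y(2)[of k] by simp
  ultimately have "(\<lambda>k. ennreal (Y k powr p) * (\<integral>\<^sup>+h. (\<integral>\<^sup>+x. (if large_inc (Y k) x h then 1 else 0) \<partial>lborel) \<partial>lborel)) \<longlonglongrightarrow>
    ennreal (2 / ?n) * (\<integral>\<^sup>+x. ennreal (Zp_polar_norm p K (grad f x) powr p) \<partial>lborel)"
    by (simp add: rescale e_def)
  then show "(\<lambda>k. ennreal (X k powr p) * (\<integral>\<^sup>+h. (\<integral>\<^sup>+x. (if large_inc (X k) x h then 1 else 0) \<partial>lborel) \<partial>lborel)) \<longlonglongrightarrow>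
    ennreal (2 / ?n) * (\<integral>\<^sup>+x. ennreal (Zp_polar_norm p K (grad f x) powr p) \<partial>lborel)"
    unfolding Y_def by (rule LIMSEQ_offset)
qed

end

section \<open>Assembly of the two bounds and the limit\<close>

theorem theorem1p1:
  "\<exists>C::real. C > 0 \<and>
    (\<forall>(K::'a::euclidean_space set) (p::real) (f::'a \<Rightarrow> real).
       sym_convex_body K \<and> 1 \<le> p \<and> Cc_infty f \<longrightarrow>
       (let I = (\<integral>\<^sup>+ x. ennreal (Zp_polar_norm p K (grad f x) powr p) \<partial>lborel);
            E = (\<lambda>l::real. {(x, y). x \<noteq> y \<and>
                   \<bar>f x - f y\<bar> / mink K (x - y) powr (real DIM('a) / p + 1) \<ge> l})
        in ennreal (2 / real DIM('a)) * I
             \<le> weak_Lp_pow p (\<lambda>(x, y). (f x - f y) / mink K (x - y) powr (real DIM('a) / p + 1))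
         \<and> weak_Lp_pow p (\<lambda>(x, y). (f x - f y) / mink K (x - y) powr (real DIM('a) / p + 1))
             \<le> ennreal C * I
         \<and> ((\<lambda>l. ennreal (l powr p) * emeasure (lborel :: ('a \<times> 'a) measure) (E l))
              \<longlongrightarrow> ennreal (2 / real DIM('a)) * I) at_top))"
\<comment> \<open>The constant of \<open>weak_bound\<close>, fixed before \<open>K\<close>,
  \<open>p\<close> and \<open>f\<close> and so depending on the dimension only.\<close>
proof (intro exI[of _ "4 * 5 ^ (DIM('a) + 1)"] conjI allI impI)
  show "0 < (4 * 5 ^ (DIM('a) + 1) :: real)" by simp
  fix K :: "'a set" and p :: real and f :: "'a \<Rightarrow> real"
  assume "sym_convex_body K \<and> 1 \<le> p \<and> Cc_infty f"
  then interpret body_fun K f p by unfold_locales auto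
  define I where "I = (\<integral>\<^sup>+ x. ennreal (Zp_polar_norm p K (grad f x) powr p) \<partial>lborel)"
  define E where "E = (\<lambda>l::real. {(x, y). x \<noteq> y \<and>
                   \<bar>f x - f y\<bar> / mink K (x - y) powr (real DIM('a) / p + 1) \<ge> l})"
  define F where "F l = ennreal (l powr p) * emeasure (lborel :: ('a \<times> 'a) measure) (E l)" for l
  have F: "F l = ennreal (l powr p) * (\<integral>\<^sup>+h. (\<integral>\<^sup>+x. (if large_inc l x h then 1 else 0) \<partial>lborel) \<partial>lborel)" for l
    unfolding F_def E_def emeasure_large_quotient ..
  have wk: "weak_Lp_pow p (\<lambda>(x, y). (f x - f y) / mink K (x - y) powr (real DIM('a) / p + 1)) = (SUP l\<in>{0<..}. F l)"
  proof -
    \<comment> \<open>On the diagonal the quotient is \<open>0 / 0 = 0\<close>, below every positive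
      level, so the weak quasinorm ignores the diagonal just as \<open>E\<close> does.\<close>
    have "{z. l \<le> \<bar>(\<lambda>(x, y). (f x - f y) / mink K (x - y) powr (real DIM('a) / p + 1)) z\<bar>} = E l"
      if "l > 0" for l
      using that by (auto simp: E_def)
    then show ?thesis unfolding weak_Lp_pow_def F_def by (intro SUP_cong) auto
  qed
  have lim: "(F \<longlongrightarrow> ennreal (2 / real DIM('a)) * I) at_top"
    unfolding F I_def by (rule weak_limit)
  \<comment> \<open>Every value \<open>F l\<close> with \<open>l > 0\<close> is at most the
    supremum, so the limit is too.\<close>
  have lower: "ennreal (2 / real DIM('a)) * I \<le> (SUP l\<in>{0<..}. F l)"
  proof (rule tendsto_upperbound[OF lim])
    show "\<forall>\<^sub>F l in at_top. F l \<le> (SUP l\<in>{0<..}. F l)"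
      using eventually_gt_at_top[of 0] by eventually_elim (auto intro: SUP_upper)
  qed simp
  have upper: "(SUP l\<in>{0<..}. F l) \<le> ennreal (4 * 5 ^ (DIM('a) + 1)) * I"
    unfolding F I_def by (intro SUP_least weak_bound) simp
  show "let I = (\<integral>\<^sup>+ x. ennreal (Zp_polar_norm p K (grad f x) powr p) \<partial>lborel);
            E = (\<lambda>l::real. {(x, y). x \<noteq> y \<and>
                   \<bar>f x - f y\<bar> / mink K (x - y) powr (real DIM('a) / p + 1) \<ge> l})
        in ennreal (2 / real DIM('a)) * I
             \<le> weak_Lp_pow p (\<lambda>(x, y). (f x - f y) / mink K (x - y) powr (real DIM('a) / p + 1))
         \<and> weak_Lp_pow p (\<lambda>(x, y). (f x - f y) / mink K (x - y) powr (real DIM('a) / p + 1))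
             \<le> ennreal (4 * 5 ^ (DIM('a) + 1)) * I
         \<and> ((\<lambda>l. ennreal (l powr p) * emeasure (lborel :: ('a \<times> 'a) measure) (E l))
              \<longlongrightarrow> ennreal (2 / real DIM('a)) * I) at_top"
    using lower upper lim
    unfolding Let_def wk I_def[symmetric] E_def[symmetric] F_def[symmetric] by blast
qed

end
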